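(* Let $p\ge2$, $X=\{0,1,\dots,p\}$, and let $\mathcal G_{S_p}$ be the group generated by the transformations $e_1,\dots,e_p$ of $X^\ast\cup X^\infty$ defined recursively by $e_i(0w)=i\,e_i(w)$, $e_i(iw)=0w$, $e_i(jw)=jw$ for $j\notin\{0,i\}$. Let $\Gamma^p$ be any infinite Schreier graph of $\mathcal G_{S_p}$ (for some $w\in X^\infty$: vertex set the orbit of $w$, with an edge joining $v$ and $e_i(v)$ for each vertex $v$ and each $i$). Define $Q_1=\{\sqrt{p^2+2p-1}\}$, $Q_{m+1}=\{\sqrt{p^2+p+sq}: q\in Q_m,\ s\in\{1,-1\}\}$, and $R_n=\{p-1+sq: q\in Q_n,\ s\in\{1,-1\}\}$ (the points $p-1\pm\sqrt{p^2+p\pm\sqrt{p^2+p\pm\cdots\pm\sqrt{p^2+2p-1}}}$ with $n$ radicals). Then the spectrum of $\Gamma^p$ is the closure of $\{2(p-1)\}\cup\bigcup_{n\ge1}R_n$. This set is the union of a Cantor set of zero Lebesgue measure which is symmetric about $p-1$ and a countable collection of isolated points supporting the KNS spectral measure $\mu$; $\mu$ is discrete, with $\mu(\{x\})=\frac{p-1}{(p+1)^{n+1}}$ for each $x\in R_n$, $n\ge1$, and $\mu(\{2(p-1)\})=\frac{p-1}{p+1}$.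
   Context: The spectrum is that of the adjacency operator on $\ell^2$ of the vertex set (loops contribute $2$ to the diagonal). Let $A_n=\sum_{i=1}^p(M_i+M_i^{T})$ be the adjacency matrix of the finite Schreier graph on $X^n$, $M_i$ the permutation matrix of $e_i$ on $X^n$. The KNS spectral measure $\mu$ is the weak limit of the counting measures $\mu_n=(p+1)^{-n}\sum_\lambda\delta_\lambda$, the sum over the eigenvalues of $A_n$ with multiplicity. *)

theory Defs
  imports "HOL-Probability.Probability" "Jordan_Normal_Form.Char_Poly"
begin

text \<open>Alphabet X = {0,...,p}. Infinite words are sequences nat => nat (with values <= p),
 finite words are lists. e_i(0w) = i e_i(w), e_i(iw) = 0w, e_i(jw) = jw (j not in {0,i}).
 On an infinite word: the maximal prefix of zeros is replaced by i's, and the first nonzero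
 letter is changed to 0 if it is i (and kept otherwise); e_i(0^omega) = i^omega.\<close>

definition e_inf :: "nat \<Rightarrow> (nat \<Rightarrow> nat) \<Rightarrow> (nat \<Rightarrow> nat)" where
  "e_inf i w = (if \<forall>n. w n = 0 then (\<lambda>_. i) else
     (let k = (LEAST k. w k \<noteq> 0) in
       (\<lambda>n. if n < k then i else if n = k then (if w k = i then 0 else w k) else w n)))"

definition e_inf_inv :: "nat \<Rightarrow> (nat \<Rightarrow> nat) \<Rightarrow> (nat \<Rightarrow> nat)" where
  "e_inf_inv i w = (if \<forall>n. w n = i then (\<lambda>_. 0) else
     (let k = (LEAST k. w k \<noteq> i) in
       (\<lambda>n. if n < k then 0 else if n = k then (if w k = 0 then i else w k) else w n)))"

fun e_fin :: "nat \<Rightarrow> nat list \<Rightarrow> nat list" where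
  "e_fin i [] = []"
| "e_fin i (a # w) = (if a = 0 then i # e_fin i w else if a = i then 0 # w else a # w)"

definition gen_step :: "nat \<Rightarrow> ((nat \<Rightarrow> nat) \<times> (nat \<Rightarrow> nat)) set" where
  "gen_step p = {(u, e_inf i u) | u i. i \<in> {1..p}}"

definition orbit :: "nat \<Rightarrow> (nat \<Rightarrow> nat) \<Rightarrow> (nat \<Rightarrow> nat) set" where
  "orbit p w = {v. (w, v) \<in> (gen_step p \<union> (gen_step p)\<inverse>)\<^sup>*}"

definition l2 :: "(nat \<Rightarrow> nat) set \<Rightarrow> ((nat \<Rightarrow> nat) \<Rightarrow> complex) set" where
  "l2 V = {f. (\<forall>v. v \<notin> V \<longrightarrow> f v = 0) \<and> (\<lambda>v. (cmod (f v))\<^sup>2) summable_on V}"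

definition l2norm :: "(nat \<Rightarrow> nat) set \<Rightarrow> ((nat \<Rightarrow> nat) \<Rightarrow> complex) \<Rightarrow> real" where
  "l2norm V f = sqrt (infsum (\<lambda>v. (cmod (f v))\<^sup>2) V)"

text \<open>Adjacency operator of the Schreier graph on V: v is joined to e_i(v) for each i,
  so (A f)(v) = sum_i (f(e_i v) + f(e_i^{-1} v)); a loop contributes 2.\<close>
definition adj :: "nat \<Rightarrow> (nat \<Rightarrow> nat) set \<Rightarrow> ((nat \<Rightarrow> nat) \<Rightarrow> complex) \<Rightarrow> ((nat \<Rightarrow> nat) \<Rightarrow> complex)" where
  "adj p V f v = (if v \<in> V then (\<Sum>i\<in>{1..p}. f (e_inf i v) + f (e_inf_inv i v)) else 0)"

definition spec :: "nat \<Rightarrow> (nat \<Rightarrow> nat) set \<Rightarrow> complex set" where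
  "spec p V = {z. \<not> (\<exists>B. (\<forall>f\<in>l2 V. B f \<in> l2 V
        \<and> B (\<lambda>v. adj p V f v - z * f v) = f
        \<and> (\<lambda>v. adj p V (B f) v - z * B f v) = f)
      \<and> (\<exists>C. \<forall>f\<in>l2 V. l2norm V (B f) \<le> C * l2norm V f))}"

fun Qset :: "nat \<Rightarrow> nat \<Rightarrow> real set" where
  "Qset p 0 = {}"
| "Qset p (Suc 0) = {sqrt (real p ^ 2 + 2 * real p - 1)}"
| "Qset p (Suc (Suc m)) = {sqrt (real p ^ 2 + real p + s * q) | q s. q \<in> Qset p (Suc m) \<and> s \<in> {1, -1}}"

definition Rset :: "nat \<Rightarrow> nat \<Rightarrow> real set" where
  "Rset p n = {real p - 1 + s * q | q s. q \<in> Qset p n \<and> s \<in> {1, -1}}"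

definition spec_set :: "nat \<Rightarrow> real set" where
  "spec_set p = closure ({2 * (real p - 1)} \<union> (\<Union>n\<in>{1..}. Rset p n))"

definition word_of :: "nat \<Rightarrow> nat \<Rightarrow> nat \<Rightarrow> nat list" where
  "word_of p n k = map (\<lambda>j. (k div (p + 1) ^ j) mod (p + 1)) [0..<n]"

definition adj_fin :: "nat \<Rightarrow> nat \<Rightarrow> real Matrix.mat" where
  "adj_fin p n = Matrix.mat ((p + 1) ^ n) ((p + 1) ^ n)
     (\<lambda>(r, c). \<Sum>i\<in>{1..p}. (if e_fin i (word_of p n r) = word_of p n c then 1 else 0)
                          + (if e_fin i (word_of p n c) = word_of p n r then 1 else 0))"

definition kns_approx :: "nat \<Rightarrow> nat \<Rightarrow> real measure" where
  "kns_approx p n = measure_of UNIV (sets borel)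
     (\<lambda>B. ennreal (\<Sum>x\<in>{x. poly (char_poly (adj_fin p n)) x = 0} \<inter> B.
          real (order x (char_poly (adj_fin p n))) / real (p + 1) ^ n))"

definition is_cantor_set :: "real set \<Rightarrow> bool" where
  "is_cantor_set C \<longleftrightarrow> C \<noteq> {} \<and> compact C \<and> (\<forall>x\<in>C. x islimpt C)
     \<and> (\<forall>x\<in>C. connected_component_set C x = {x})"

end

theory Submission
  imports Defs
begin

text \<open>
  Group the vertices of a Schreier graph by their first letter. The adjacency operator becomes a star
  of blocks: the letter \<open>i \<ge> 1\<close> is coupled only to the letter \<open>0\<close>, by \<open>1 + e\<^sub>i\<close>, and the diagonal
  blocks are the scalars \<open>0\<close> and \<open>2 (p - 1)\<close>. Since \<open>e\<^sub>i\<close> acts unitarily, the Schur complement onto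
  the letter \<open>0\<close> is the adjacency operator of the graph of tails. In the coordinate
  \<open>\<lambda> = p - 1 + y\<close> the spectral parameter is thereby renormalised by \<open>y \<mapsto> y\<^sup>2 - p (p + 1)\<close>, except at
  \<open>y = p - 1\<close>, which is an eigenvalue at every level. So the spectrum consists of the backward orbit
  of \<open>p - 1\<close> together with the Julia set of this quadratic map, which is hyperbolic with escaping
  critical point: real points with bounded orbit are expanded by at least \<open>2 sqrt 3\<close>, nonreal points
  escape. The same Schur complement applied to characteristic polynomials gives the multiplicities
  \<open>(p - 1) (p + 1) ^ (n - 1 - k)\<close> of the points of \<open>R\<^sub>k\<close> at level \<open>n\<close>.
\<close>

section \<open>The quadratic map and its Julia set\<close>

text \<open>Write the spectral parameter as \<open>y + p - 1\<close> and put
  \<open>m = y - (p - 1)\<close>, its difference from the diagonal value \<open>2 (p - 1)\<close>.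
  Eliminating the letters \<open>i \<ge> 1\<close> divides by \<open>m\<close>, hence the
  exceptional point, and uses \<open>(\<Sum>i. (1 + e_i) (1 + e_i\<inverse>)) = 2 p + A\<close>. The
  new parameter is \<open>m (y + p - 1) - 2 p\<close>; centring it at \<open>p - 1\<close> again
  removes the linear term and leaves the constant \<open>p (p + 1)\<close>. Passing to tails changes
  the vertex set, so the operator is studied on arbitrary nonempty sets closed under the generators
  and their inverses, and the spectrum comes out the same for all of them. A parameter whose orbit
  escapes without meeting \<open>p - 1\<close> is pulled back from the region where the Neumann
  series converges; nonreal parameters fall under this case because the imaginary part at least
  doubles along a bounded orbit. For the measure, lower bounds on multiplicities suffice: the levels
  below \<open>n\<close> carry mass \<open>1 - (2 / (p + 1)) ^ n\<close>, which leaves no room for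
  anything else in the limit.\<close>

definition qmap :: "nat \<Rightarrow> 'a::real_normed_field \<Rightarrow> 'a" where
  "qmap p y = y\<^sup>2 - of_nat p * (of_nat p + 1)"

definition preim :: "nat \<Rightarrow> real \<Rightarrow> nat \<Rightarrow> real set" where
  "preim p t n = {y. (qmap p ^^ n) y = t}"

text \<open>The radius is the larger fixed point of \<open>qmap p\<close>: beyond it in norm every
  orbit diverges, so these are the real points with bounded orbit.\<close>

definition julia :: "nat \<Rightarrow> real set" where
  "julia p = {y. \<forall>n. \<bar>(qmap p ^^ n) y\<bar> \<le> real p + 1}"

lemma qmap_of_real: "qmap p (of_real x) = of_real (qmap p x)"
  by (simp add: qmap_def)

lemma funpow_qmap_of_real: "(qmap p ^^ n) (of_real x) = of_real ((qmap p ^^ n) x)"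
  by (induction n) (simp_all add: qmap_of_real)

section \<open>Escape to infinity and the gap around the critical point\<close>

text \<open>Since \<open>p + 1\<close> is fixed, \<open>norm y ^ 2 - (p + 1)\<^sup>2\<close>
  factors, and the factor \<open>norm y + (p + 1)\<close> is at least 2. A general normed field is
  used because both real and complex orbits occur.\<close>

lemma qmap_escape:
  fixes y :: "'a::real_normed_field"
  assumes "norm y \<ge> real p + 1"
  shows "norm (qmap p y) - (real p + 1) \<ge> 2 * (norm y - (real p + 1))"
proof -
  have "norm (qmap p y) \<ge> norm (y\<^sup>2) - norm (of_nat p * (of_nat p + 1) :: 'a)"
    unfolding qmap_def by (rule norm_triangle_ineq2)
  moreover have "norm (of_nat p * (of_nat p + 1) :: 'a) = real p * (real p + 1)"
    by (metis norm_of_nat of_nat_1 of_nat_add of_nat_mult)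
  ultimately have "norm (qmap p y) \<ge> norm y ^ 2 - real p * (real p + 1)"
    by (simp add: norm_power)
  moreover have "norm y ^ 2 - real p * (real p + 1) - (real p + 1)
      = (norm y - (real p + 1)) * (norm y + (real p + 1))"
    by (simp add: power2_eq_square algebra_simps)
  moreover have "(norm y - (real p + 1)) * (norm y + (real p + 1)) \<ge> (norm y - (real p + 1)) * 2"
    using assms by (intro mult_left_mono) auto
  ultimately show ?thesis by linarith
qed

lemma funpow_qmap_escape:
  fixes y :: "'a::real_normed_field"
  assumes "norm y \<ge> real p + 1"
  shows "norm ((qmap p ^^ n) y) - (real p + 1) \<ge> 2 ^ n * (norm y - (real p + 1))"
proof (induction n)
  case (Suc n)
  have "0 \<le> 2 ^ n * (norm y - (real p + 1))"
    using assms by simp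
  then have "norm ((qmap p ^^ n) y) \<ge> real p + 1"
    using Suc by linarith
  from qmap_escape[OF this] Suc show ?case by simp
qed simp

lemma norm_le_if_funpow_qmap_le:
  fixes y :: "'a::real_normed_field"
  assumes "norm ((qmap p ^^ n) y) \<le> real p + 1"
  shows "norm y \<le> real p + 1"
proof (rule ccontr)
  assume *: "\<not> norm y \<le> real p + 1"
  then have "2 ^ n * (norm y - (real p + 1)) > 0" by simp
  then show False using funpow_qmap_escape[of p y n] * assms by linarith
qed

text \<open>An orbit that leaves the ball never returns, so one late iterate inside it controls all
  earlier ones.\<close>

lemma funpow_qmap_le_mono:
  fixes y :: "'a::real_normed_field"
  assumes "norm ((qmap p ^^ n) y) \<le> real p + 1" "m \<le> n"
  shows "norm ((qmap p ^^ m) y) \<le> real p + 1"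
proof -
  have "(qmap p ^^ n) y = (qmap p ^^ (n - m)) ((qmap p ^^ m) y)"
    using assms(2) by (metis comp_apply funpow_add le_add_diff_inverse2)
  then show ?thesis using assms(1) norm_le_if_funpow_qmap_le by metis
qed

text \<open>Keeps bounded orbits away from the critical point 0. For \<open>p \<ge> 2\<close> the
  bound is at least 3, the origin of \<open>sqrt 3\<close>; it also exceeds
  \<open>(p - 1)\<^sup>2\<close>, which later isolates \<open>p - 1\<close>.\<close>

lemma qmap_le_imp_abs_ge:
  fixes y :: real
  assumes "\<bar>qmap p y\<bar> \<le> real p + 1"
  shows "y\<^sup>2 \<ge> (real p)\<^sup>2 - 1"
  using assms by (simp add: qmap_def power2_eq_square algebra_simps)

lemma sqrt3_le_abs:
  fixes y :: real
  assumes "p \<ge> 2" "\<bar>qmap p y\<bar> \<le> real p + 1"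
  shows "\<bar>y\<bar> \<ge> sqrt 3"
proof -
  have "real p ^ 2 \<ge> 2 ^ 2" using assms(1) by (intro power_mono) auto
  then have "y\<^sup>2 \<ge> 3" using qmap_le_imp_abs_ge[OF assms(2)] by simp
  then show ?thesis
    by (metis real_sqrt_abs real_sqrt_le_iff)
qed

text \<open>The imaginary part is multiplied by \<open>2 * Re u\<close> at each step. A bounded next
  iterate forces \<open>\<bar>Re u\<bar> \<ge> 1\<close>, because \<open>Re (qmap p u)\<close> could
  not otherwise be as large as \<open>- (p + 1)\<close>. So a nonzero imaginary part would grow
  without bound.\<close>

lemma Im_eq_0_if_funpow_qmap_bounded:
  fixes z :: complex
  assumes p: "p \<ge> 2" and bd: "\<And>n. norm ((qmap p ^^ n) z) \<le> real p + 1"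
  shows "Im z = 0"
proof -
  have step: "\<bar>Im (qmap p u)\<bar> \<ge> 2 * \<bar>Im u\<bar>" if "norm (qmap p u) \<le> real p + 1" for u :: complex
  proof -
    have "Re (qmap p u) \<ge> - (real p + 1)"
      using that abs_Re_le_cmod[of "qmap p u"] by linarith
    then have "(Re u)\<^sup>2 \<ge> (Im u)\<^sup>2 + real p ^ 2 - 1"
      by (simp add: qmap_def power2_eq_square algebra_simps)
    moreover have "real p ^ 2 \<ge> 4" using p power_mono[of 2 "real p" 2] by simp
    ultimately have "1 \<le> (Re u)\<^sup>2"
      using zero_le_power2[of "Im u"] by linarith
    then have "1\<^sup>2 \<le> (Re u)\<^sup>2" by simp
    then have "\<bar>Re u\<bar> \<ge> 1"
      by (metis abs_le_square_iff abs_one)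
    moreover have "Im (qmap p u) = 2 * Re u * Im u"
      by (simp add: qmap_def power2_eq_square)
    ultimately show ?thesis
      by (simp add: abs_mult mult_le_cancel_right1)
  qed
  have grow: "\<bar>Im ((qmap p ^^ n) z)\<bar> \<ge> 2 ^ n * \<bar>Im z\<bar>" for n
  proof (induction n)
    case (Suc n)
    then show ?case using step[of "(qmap p ^^ n) z"] bd[of "Suc n"] by simp
  qed simp
  show ?thesis
  proof (rule ccontr)
    assume "Im z \<noteq> 0"
    then obtain n where "2 ^ n > (real p + 1) / \<bar>Im z\<bar>"
      using real_arch_pow[of 2 "(real p + 1) / \<bar>Im z\<bar>"] by auto
    then have "2 ^ n * \<bar>Im z\<bar> > real p + 1"
      using \<open>Im z \<noteq> 0\<close> by (simp add: field_simps)
    then show False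
      using grow[of n] bd[of n] abs_Im_le_cmod[of "(qmap p ^^ n) z"] by linarith
  qed
qed

section \<open>Backward orbits\<close>

lemma preim_0 [simp]: "preim p t 0 = {t}"
  by (auto simp: preim_def)

lemma preim_Suc: "preim p t (Suc n) = qmap p -` preim p t n"
  by (auto simp: preim_def funpow_swap1)

lemma funpow_preim: "y \<in> preim p t n \<Longrightarrow> m \<le> n \<Longrightarrow> (qmap p ^^ m) y \<in> preim p t (n - m)"
  unfolding preim_def by (metis comp_apply funpow_add le_add_diff_inverse2 mem_Collect_eq)

lemma preim_abs_le:
  assumes "y \<in> preim p t n" "\<bar>t\<bar> \<le> real p + 1"
  shows "\<bar>y\<bar> \<le> real p + 1"
  using norm_le_if_funpow_qmap_le[where p = p and n = n and y = y] assms by (auto simp: preim_def)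

lemma qmap_fibre:
  fixes t :: real
  assumes "t > - (real p * (real p + 1))"
  shows "card {y. qmap p y = t} = 2" "finite {y. qmap p y = t}"
proof -
  let ?s = "sqrt (t + real p * (real p + 1))"
  have "?s > 0" using assms by simp
  have "qmap p y = t \<longleftrightarrow> y\<^sup>2 = ?s\<^sup>2" for y using assms by (auto simp: qmap_def)
  then have "{y. qmap p y = t} = {?s, - ?s}"
    by (auto simp: power2_eq_iff)
  then show "card {y. qmap p y = t} = 2" "finite {y. qmap p y = t}"
    using \<open>?s > 0\<close> by (auto simp: card_insert_if)
qed

text \<open>The critical value \<open>- p (p + 1)\<close> lies strictly below the interval of radius
  \<open>p + 1\<close>, so every point of that interval has two distinct real preimages, at every
  depth.\<close>

lemma critical_value_lt:
  fixes t :: real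
  assumes "p \<ge> 2" "\<bar>t\<bar> \<le> real p + 1"
  shows "t > - (real p * (real p + 1))"
proof -
  define m where "m = real p * (real p + 1)"
  have "m \<ge> 2 * (real p + 1)"
    unfolding m_def using assms(1) by (intro mult_right_mono) auto
  moreover have "real p \<ge> 2" using assms(1) by simp
  moreover have "t \<ge> - (real p + 1)" using assms(2) by (simp add: abs_le_iff)
  ultimately show ?thesis unfolding m_def[symmetric] by argo
qed

lemma finite_card_preim:
  assumes "p \<ge> 2" "\<bar>t\<bar> \<le> real p + 1"
  shows "finite (preim p t n) \<and> card (preim p t n) = 2 ^ n"
proof (induction n)
  case (Suc n)
  have eq: "preim p t (Suc n) = (\<Union>u\<in>preim p t n. {y. qmap p y = u})"
    by (auto simp: preim_Suc)
  have gt: "u > - (real p * (real p + 1))" if "u \<in> preim p t n" for u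
    using critical_value_lt[OF assms(1)] preim_abs_le[OF that assms(2)] by blast
  have "card (preim p t (Suc n)) = (\<Sum>u\<in>preim p t n. card {y::real. qmap p y = u})"
    unfolding eq using Suc gt qmap_fibre by (intro card_UN_disjoint) auto
  also have "\<dots> = (\<Sum>u\<in>preim p t n. 2)"
    using gt qmap_fibre by (intro sum.cong) auto
  finally show ?case using Suc gt qmap_fibre(2) by (auto simp: eq)
qed simp

section \<open>Topology and measure of the Julia set\<close>

lemma julia_abs_le: "x \<in> julia p \<Longrightarrow> \<bar>(qmap p ^^ n) x\<bar> \<le> real p + 1"
  by (auto simp: julia_def)

lemma qmap_julia: "x \<in> julia p \<Longrightarrow> qmap p x \<in> julia p"
  unfolding julia_def by (auto simp flip: funpow_swap1) (metis comp_apply funpow.simps(2) funpow_swap1)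

lemma funpow_qmap_julia: "x \<in> julia p \<Longrightarrow> (qmap p ^^ n) x \<in> julia p"
  by (induction n) (auto intro: qmap_julia)

lemma julia_sqrt3_le:
  assumes "p \<ge> 2" "x \<in> julia p" shows "\<bar>x\<bar> \<ge> sqrt 3"
  using sqrt3_le_abs[OF assms(1)] julia_abs_le[OF assms(2), of 1] by simp

text \<open>Pulling back along the branch of the inverse that has the sign of \<open>x\<close> contracts by \<open>2 sqrt 3\<close>,
  since \<open>qmap p x - qmap p y = (x + y) * (x - y)\<close>.\<close>

lemma julia_approx_preim:
  assumes p: "p \<ge> 2" and t: "\<bar>t\<bar> \<le> real p + 1" and x: "x \<in> julia p"
  shows "\<exists>y\<in>preim p t n. \<bar>x - y\<bar> \<le> 2 * (real p + 1) / (2 * sqrt 3) ^ n"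
  using x
proof (induction n arbitrary: x)
  case 0
  then show ?case using julia_abs_le[OF 0, of 0] t by auto
next
  case (Suc n)
  obtain u where u: "u \<in> preim p t n" "\<bar>qmap p x - u\<bar> \<le> 2 * (real p + 1) / (2 * sqrt 3) ^ n"
    using Suc.IH[OF qmap_julia[OF Suc.prems]] by blast
  have gt: "u > - (real p * (real p + 1))"
    using critical_value_lt[OF p] preim_abs_le[OF u(1) t] by blast
  define y where "y = sgn x * sqrt (u + real p * (real p + 1))"
  have x3: "\<bar>x\<bar> \<ge> sqrt 3" by (rule julia_sqrt3_le[OF p Suc.prems])
  then have "x \<noteq> 0" by auto
  then have sg: "sgn x * sgn x = 1" by (simp add: sgn_if)
  have qy: "qmap p y = u"
    using gt sg by (simp add: qmap_def y_def power2_eq_square algebra_simps)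
  then have "\<bar>y\<bar> \<ge> sqrt 3"
    using sqrt3_le_abs[OF p] preim_abs_le[OF u(1) t] by blast
  moreover have "\<bar>x + y\<bar> = \<bar>x\<bar> + \<bar>y\<bar>"
  proof -
    define r where "r = sqrt (u + real p * (real p + 1))"
    have "r \<ge> 0" using gt by (simp add: r_def)
    then show ?thesis
      unfolding y_def r_def[symmetric] by (cases "x > 0") (auto simp: sgn_if)
  qed
  ultimately have xy: "\<bar>x + y\<bar> \<ge> 2 * sqrt 3" using x3 by simp
  have "\<bar>qmap p x - u\<bar> = \<bar>x + y\<bar> * \<bar>x - y\<bar>"
    unfolding qy[symmetric] by (simp add: qmap_def power2_eq_square algebra_simps flip: abs_mult)
  then have "(2 * sqrt 3) * \<bar>x - y\<bar> \<le> 2 * (real p + 1) / (2 * sqrt 3) ^ n"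
    using u(2) mult_right_mono[OF xy abs_ge_zero[of "x - y"]] by linarith
  then have "\<bar>x - y\<bar> \<le> 2 * (real p + 1) / (2 * sqrt 3) ^ Suc n"
    by (simp add: field_simps)
  moreover have "y \<in> preim p t (Suc n)" using qy u(1) by (simp add: preim_Suc)
  ultimately show ?case by blast
qed

lemma contraction_tendsto_0: "(\<lambda>n. c / (2 * sqrt 3) ^ n) \<longlonglongrightarrow> 0"
proof -
  have "sqrt 3 > 1" by simp
  then have "2 * sqrt 3 > 1" by linarith
  from LIMSEQ_divide_realpow_zero[OF this] show ?thesis .
qed

text \<open>Two targets at a common depth: for different targets the two approximants are different,
  so at least one of them is not \<open>x\<close>. With equal targets this is plain density.\<close>

lemma julia_close_preim:
  assumes "p \<ge> 2" "\<bar>t\<bar> \<le> real p + 1" "\<bar>u\<bar> \<le> real p + 1" "x \<in> julia p" "e > 0"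
  shows "\<exists>n. \<exists>y\<in>preim p t n. \<exists>z\<in>preim p u n. \<bar>x - y\<bar> < e \<and> \<bar>x - z\<bar> < e"
proof -
  obtain n where n: "2 * (real p + 1) / (2 * sqrt 3) ^ n < e"
    using order_tendstoD(2)[OF contraction_tendsto_0 assms(5)] by (auto simp: eventually_sequentially)
  then show ?thesis
    using julia_approx_preim[OF assms(1,2,4), of n] julia_approx_preim[OF assms(1,3,4), of n]
    by (meson le_less_trans)
qed

lemma continuous_on_funpow_qmap:
  "continuous_on S (qmap p ^^ n :: real \<Rightarrow> real)"
proof (induction n)
  case 0
  then show ?case by (simp add: id_def)
next
  case (Suc n)
  have eq: "qmap p ^^ Suc n = (\<lambda>y::real. ((qmap p ^^ n) y)\<^sup>2 - real p * (real p + 1))"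
    by (auto simp: qmap_def)
  show ?case unfolding eq by (intro continuous_intros Suc)
qed

lemma compact_julia: "compact (julia p)"
proof -
  have "closed {y::real. \<bar>(qmap p ^^ n) y\<bar> \<le> real p + 1}" for n
    by (intro closed_Collect_le continuous_intros continuous_on_funpow_qmap)
  moreover have "julia p = (\<Inter>n. {y. \<bar>(qmap p ^^ n) y\<bar> \<le> real p + 1})"
    by (auto simp: julia_def)
  ultimately have "closed (julia p)" by auto
  moreover have "bounded (julia p)"
    using julia_abs_le[where n = 0] by (auto simp: bounded_iff)
  ultimately show ?thesis by (simp add: compact_eq_bounded_closed)
qed

text \<open>After \<open>n\<close> steps the orbit stays at the fixed point, and before that it
  cannot have left the interval, since it would not have come back.\<close>

lemma preim_fixed_subset_julia:
  assumes "qmap p t = t" "\<bar>t\<bar> \<le> real p + 1"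
  shows "preim p t n \<subseteq> julia p"
proof
  fix y assume y: "y \<in> preim p t n"
  have fx: "(qmap p ^^ k) t = t" for k by (induction k) (auto simp: assms)
  have "\<bar>(qmap p ^^ m) y\<bar> \<le> real p + 1" for m
  proof (cases "m \<le> n")
    case True
    then show ?thesis using funpow_qmap_le_mono[where p = p and n = n and y = y and m = m] y assms by (auto simp: preim_def)
  next
    case False
    then have "(qmap p ^^ m) y = (qmap p ^^ (m - n)) ((qmap p ^^ n) y)"
      by (metis comp_apply funpow_add le_add_diff_inverse2 linear)
    then show ?thesis using y fx assms by (simp add: preim_def)
  qed
  then show "y \<in> julia p" by (simp add: julia_def)
qed

text \<open>Both fixed points \<open>p + 1\<close> and \<open>- p\<close> have their backward orbits
  inside the Julia set. Approximating \<open>x\<close> from both at the same depth gives two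
  distinct points of the set near \<open>x\<close>.\<close>

lemma islimpt_julia:
  assumes p: "p \<ge> 2" and x: "x \<in> julia p"
  shows "x islimpt julia p"
proof -
  have "\<exists>y\<in>julia p. y \<noteq> x \<and> dist y x < e" if e: "e > 0" for e
  proof -
    have ab: "\<bar>real p + 1\<bar> \<le> real p + 1" "\<bar>- real p\<bar> \<le> real p + 1" by auto
    obtain n y z where yz: "y \<in> preim p (real p + 1) n" "z \<in> preim p (- real p) n"
        "\<bar>x - y\<bar> < e" "\<bar>x - z\<bar> < e"
      using julia_close_preim[OF p ab x e] by blast
    have "qmap p (real p + 1) = real p + 1" "qmap p (- real p) = - real p"
      by (simp_all add: qmap_def power2_eq_square algebra_simps)
    then have "y \<in> julia p" "z \<in> julia p"
      using yz preim_fixed_subset_julia ab by blast+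
    moreover have "y \<noteq> z" using yz(1,2) by (auto simp: preim_def)
    ultimately show ?thesis using yz by (metis dist_real_def dist_commute)
  qed
  then show ?thesis by (simp add: islimpt_approachable)
qed

text \<open>Iterates of a connected subset are connected subsets of the Julia set, which avoids 0;
  so two points of it keep a common sign, their sum has absolute value at least 2, and their
  distance doubles with each iteration inside a bounded set.\<close>

lemma connected_component_julia:
  assumes p: "p \<ge> 2" and x: "x \<in> julia p"
  shows "connected_component_set (julia p) x = {x}"
proof -
  have "a = b" if K: "connected K" "K \<subseteq> julia p" "a \<in> K" "b \<in> K" for K a b
  proof -
    have same: "\<bar>c + d\<bar> \<ge> 2" if "connected L" "L \<subseteq> julia p" "c \<in> L" "d \<in> L" for L c d
    proof -
      have ge1: "\<bar>u\<bar> \<ge> 1" if "u \<in> L" for u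
      proof -
        have "sqrt 3 \<ge> 1" by simp
        moreover have "\<bar>u\<bar> \<ge> sqrt 3" using julia_sqrt3_le[OF p] \<open>L \<subseteq> julia p\<close> that by blast
        ultimately show ?thesis by (rule order_trans)
      qed
      then have "0 \<notin> L" by fastforce
      then have "\<not> (c \<le> 0 \<and> 0 \<le> d)" "\<not> (d \<le> 0 \<and> 0 \<le> c)"
        using that unfolding connected_iff_interval by blast+
      moreover have "\<bar>c\<bar> \<ge> 1" "\<bar>d\<bar> \<ge> 1"
        using ge1 that by blast+
      ultimately show ?thesis by linarith
    qed
    have "\<bar>(qmap p ^^ n) a - (qmap p ^^ n) b\<bar> \<ge> 2 ^ n * \<bar>a - b\<bar>" for n
    proof (induction n)
      case (Suc n)
      let ?a = "(qmap p ^^ n) a" and ?b = "(qmap p ^^ n) b"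
      have "\<bar>?a + ?b\<bar> \<ge> 2"
      proof (rule same)
        show "connected ((qmap p ^^ n) ` K)"
          by (intro connected_continuous_image continuous_on_funpow_qmap K)
        show "(qmap p ^^ n) ` K \<subseteq> julia p" using K funpow_qmap_julia by blast
      qed (use K in auto)
      moreover have "\<bar>qmap p ?a - qmap p ?b\<bar> = \<bar>?a + ?b\<bar> * \<bar>?a - ?b\<bar>"
        by (simp add: qmap_def power2_eq_square algebra_simps flip: abs_mult)
      ultimately have "\<bar>qmap p ?a - qmap p ?b\<bar> \<ge> 2 * \<bar>?a - ?b\<bar>"
        by (simp add: mult_right_mono)
      then show ?case using Suc by simp
    qed simp
    moreover have "\<bar>(qmap p ^^ n) a - (qmap p ^^ n) b\<bar> \<le> 2 * (real p + 1)" for n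
      using julia_abs_le[of a p n] julia_abs_le[of b p n] K by fastforce
    ultimately have bd: "2 ^ n * \<bar>a - b\<bar> \<le> 2 * (real p + 1)" for n
      by (meson order_trans)
    show "a = b"
    proof (rule ccontr)
      assume "a \<noteq> b"
      then obtain n where "2 ^ n > 2 * (real p + 1) / \<bar>a - b\<bar>"
        using real_arch_pow[of 2 "2 * (real p + 1) / \<bar>a - b\<bar>"] by auto
      then have "2 ^ n * \<bar>a - b\<bar> > 2 * (real p + 1)"
        using \<open>a \<noteq> b\<close> by (simp add: field_simps)
      then show False using bd[of n] by linarith
    qed
  qed
  then show ?thesis
    using x by (auto simp: connected_component_def)
qed

lemma abs_center_le: "p \<ge> 2 \<Longrightarrow> \<bar>real p - 1\<bar> \<le> real p + 1"
  by auto

text \<open>The set is covered by \<open>2 ^ n\<close> intervals of radius proportional to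
  \<open>(2 * sqrt 3) ^ - n\<close>: contraction beats branching, and the total length decays like
  \<open>(1 / sqrt 3) ^ n\<close>.\<close>

lemma julia_null:
  assumes p: "p \<ge> 2"
  shows "julia p \<in> null_sets lborel"
proof -
  let ?r = "\<lambda>n. 2 * (real p + 1) / (2 * sqrt 3) ^ n"
  have bor: "julia p \<in> sets borel"
    by (intro borel_closed compact_imp_closed compact_julia)
  have le: "emeasure lborel (julia p) \<le> ennreal (4 * (real p + 1) * (1 / sqrt 3) ^ n)" for n
  proof -
    let ?S = "preim p (real p - 1) n"
    have fin: "finite ?S" and card: "card ?S = 2 ^ n"
      using finite_card_preim[OF p abs_center_le[OF p]] by auto
    have sub: "julia p \<subseteq> (\<Union>y\<in>?S. {y - ?r n .. y + ?r n})"
    proof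
      fix x assume "x \<in> julia p"
      then obtain y where "y \<in> ?S" "\<bar>x - y\<bar> \<le> ?r n"
        using julia_approx_preim[OF p abs_center_le[OF p]] by blast
      then show "x \<in> (\<Union>y\<in>?S. {y - ?r n .. y + ?r n})"
        by (intro UN_I[of y]) (simp_all only: atLeastAtMost_iff, linarith)
    qed
    have "emeasure lborel (julia p) \<le> emeasure lborel (\<Union>y\<in>?S. {y - ?r n .. y + ?r n})"
      using fin by (intro emeasure_mono sub) (auto intro!: sets.finite_UN)
    also have "\<dots> \<le> (\<Sum>y\<in>?S. emeasure lborel {y - ?r n .. y + ?r n})"
      using fin by (intro emeasure_subadditive_finite) auto
    also have "\<dots> = (\<Sum>y\<in>?S. ennreal (2 * ?r n))"
      by (intro sum.cong refl) (subst emeasure_lborel_Icc, auto)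
    also have "\<dots> = ennreal (2 ^ n * (2 * ?r n))"
      by (subst sum_ennreal) (simp_all only: sum_constant card of_nat_power of_nat_numeral, simp)
    also have "2 ^ n * (2 * ?r n) = 4 * (real p + 1) * (1 / sqrt 3) ^ n"
      by (simp add: power_mult_distrib power_divide field_simps)
    finally show ?thesis .
  qed
  have "(\<lambda>n. (1 / sqrt 3) ^ n) \<longlonglongrightarrow> 0"
    by (intro LIMSEQ_power_zero) (simp add: real_sqrt_gt_1_iff)
  then have "(\<lambda>n. ennreal (4 * (real p + 1) * (1 / sqrt 3) ^ n)) \<longlonglongrightarrow> ennreal (4 * (real p + 1) * 0)"
    by (intro tendsto_ennrealI tendsto_mult_left)
  then have "emeasure lborel (julia p) \<le> 0"
    using le by (intro LIMSEQ_le_const) auto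
  then show ?thesis using bor by (auto simp: null_sets_def)
qed

section \<open>The backward orbit of \<open>p - 1\<close> and its closure\<close>

text \<open>A point at two depths would make \<open>p - 1\<close> return to itself, but
  \<open>qmap p (p - 1) = 1 - 3 p\<close> is already outside the interval of radius
  \<open>p + 1\<close>, from which no orbit returns.\<close>

lemma preim_center_disjoint:
  assumes p: "p \<ge> 2" and "y \<in> preim p (real p - 1) m" "y \<in> preim p (real p - 1) n"
  shows "m = n"
proof -
  have False if "y \<in> preim p (real p - 1) k" "y \<in> preim p (real p - 1) l" "k < l" for k l
  proof -
    have "(qmap p ^^ k) y = real p - 1" using that(1) by (simp add: preim_def)
    then have "real p - 1 \<in> preim p (real p - 1) (l - k)"
      using funpow_preim[OF that(2), of k] that(3) by simp
    moreover have "l - k = Suc (l - k - 1)" using that(3) by simp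
    ultimately have "qmap p (real p - 1) \<in> preim p (real p - 1) (l - k - 1)"
      by (metis preim_Suc vimageE)
    then have "\<bar>qmap p (real p - 1)\<bar> \<le> real p + 1"
      using preim_abs_le abs_center_le[OF p] by blast
    then show False using p by (simp add: qmap_def power2_eq_square algebra_simps)
  qed
  then show ?thesis using assms by (metis linorder_neqE_nat)
qed

definition preims :: "nat \<Rightarrow> real set" where
  "preims p = (\<Union>n. preim p (real p - 1) n)"

text \<open>Depth 0 is excluded because \<open>p - 1\<close> itself violates the bound; this gap
  separates it from everything else in the set.\<close>

lemma preims_square_ge:
  assumes p: "p \<ge> 2" and y: "y \<in> julia p \<or> (\<exists>k>0. y \<in> preim p (real p - 1) k)"
  shows "\<bar>y\<bar>\<^sup>2 \<ge> real p ^ 2 - 1"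
proof -
  have "\<bar>qmap p y\<bar> \<le> real p + 1"
    using y
  proof
    assume "y \<in> julia p"
    then show ?thesis using julia_abs_le[of y p 1] by simp
  next
    assume "\<exists>k>0. y \<in> preim p (real p - 1) k"
    then obtain k where "y \<in> preim p (real p - 1) (Suc k)" by (metis gr0_implies_Suc)
    then show ?thesis using preim_abs_le abs_center_le[OF p] by (auto simp: preim_Suc)
  qed
  then show ?thesis using qmap_le_imp_abs_ge by simp
qed

text \<open>Pull back the gap around \<open>p - 1\<close> by the \<open>n\<close>-th iterate. In the
  resulting neighbourhood of \<open>x\<close> there is no point of the Julia set and no preimage of
  depth above \<open>n\<close>, since the iterate of either would lie outside the gap. Only finitely
  many preimages remain.\<close>

lemma preims_isolated:
  assumes p: "p \<ge> 2" and x: "x \<in> preims p"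
  shows "\<not> x islimpt (julia p \<union> preims p)"
proof
  assume lim: "x islimpt (julia p \<union> preims p)"
  obtain n where n: "(qmap p ^^ n) x = real p - 1"
    using x by (auto simp: preims_def preim_def)
  let ?U = "{y::real. ((qmap p ^^ n) y)\<^sup>2 < real p ^ 2 - 1}"
  have op: "open ?U"
    by (intro open_Collect_less continuous_intros continuous_on_funpow_qmap)
  moreover have "x \<in> ?U" unfolding mem_Collect_eq n using p by (simp add: power2_eq_square algebra_simps)
  ultimately have "x islimpt ((julia p \<union> preims p) \<inter> ?U)"
    by (intro islimpt_Int_eventually[OF lim] eventually_at_in_open')
  moreover have "finite ((julia p \<union> preims p) \<inter> ?U)"
  proof (rule finite_subset)
    show "(julia p \<union> preims p) \<inter> ?U \<subseteq> (\<Union>k\<le>n. preim p (real p - 1) k)"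
    proof
      fix y assume y: "y \<in> (julia p \<union> preims p) \<inter> ?U"
      then have lt: "((qmap p ^^ n) y)\<^sup>2 < real p ^ 2 - 1" by simp
      have "(qmap p ^^ n) y \<notin> julia p" using preims_square_ge[OF p] lt by (metis not_less power2_abs)
      then have "y \<notin> julia p" using funpow_qmap_julia by blast
      then obtain k where k: "y \<in> preim p (real p - 1) k" using y by (auto simp: preims_def)
      have "k \<le> n"
      proof (rule ccontr)
        assume "\<not> k \<le> n"
        then have "(qmap p ^^ n) y \<in> preim p (real p - 1) (k - n)" "k - n > 0"
          using funpow_preim[OF k, of n] by auto
        then show False using preims_square_ge[OF p] lt by (metis not_less power2_abs)
      qed
      then show "y \<in> (\<Union>k\<le>n. preim p (real p - 1) k)" using k by blast
    qed
    show "finite (\<Union>k\<le>n. preim p (real p - 1) k)"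
      using finite_card_preim[OF p abs_center_le[OF p]] by auto
  qed
  ultimately show False using islimpt_finite by blast
qed

text \<open>For the inclusion from left to right, a point outside the Julia set has a neighbourhood
  that has escaped at some time \<open>n\<close>. A preimage of depth above \<open>n\<close> has not
  escaped by then, so the neighbourhood meets only finitely many preimages, and a finite set is
  closed.\<close>

lemma closure_preims:
  assumes p: "p \<ge> 2"
  shows "closure (preims p) = julia p \<union> preims p"
proof
  have "julia p \<subseteq> closure (preims p)"
  proof
    fix x assume x: "x \<in> julia p"
    have "\<exists>y\<in>preims p. dist y x < e" if e: "e > 0" for e
    proof -
      obtain n y where "y \<in> preim p (real p - 1) n" "\<bar>x - y\<bar> < e"
        using julia_close_preim[OF p abs_center_le[OF p] abs_center_le[OF p] x e] by blast
      then show ?thesis unfolding preims_def dist_real_def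
        by (metis UN_I UNIV_I abs_minus_commute)
    qed
    then show "x \<in> closure (preims p)" by (simp add: closure_approachable)
  qed
  then show "julia p \<union> preims p \<subseteq> closure (preims p)" using closure_subset by blast
  show "closure (preims p) \<subseteq> julia p \<union> preims p"
  proof
    fix z assume z: "z \<in> closure (preims p)"
    show "z \<in> julia p \<union> preims p"
    proof (cases "z \<in> julia p")
      case False
      then obtain n where n: "\<bar>(qmap p ^^ n) z\<bar> > real p + 1"
        by (auto simp: julia_def not_le)
      let ?U = "{y::real. \<bar>(qmap p ^^ n) y\<bar> > real p + 1}"
      have op: "open ?U"
        by (intro open_Collect_less continuous_intros continuous_on_funpow_qmap)
      have "z \<in> closure (?U \<inter> preims p)"
        using open_Int_closure_subset[OF op, of "preims p"] z n by blast
      moreover have "?U \<inter> preims p \<subseteq> (\<Union>k\<le>n. preim p (real p - 1) k)"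
      proof
        fix y assume y: "y \<in> ?U \<inter> preims p"
        then obtain k where k: "y \<in> preim p (real p - 1) k" by (auto simp: preims_def)
        have "k \<le> n"
        proof (rule ccontr)
          assume "\<not> k \<le> n"
          then have "(qmap p ^^ n) y \<in> preim p (real p - 1) (k - n)"
            using funpow_preim[OF k, of n] by auto
          then show False using y preim_abs_le[OF _ abs_center_le[OF p]] by fastforce
        qed
        then show "y \<in> (\<Union>k\<le>n. preim p (real p - 1) k)" using k by blast
      qed
      moreover have "finite (\<Union>k\<le>n. preim p (real p - 1) k)"
        using finite_card_preim[OF p abs_center_le[OF p]] by auto
      ultimately have "z \<in> ?U \<inter> preims p"
        by (metis closure_closed finite_imp_closed finite_subset)
      then show ?thesis by blast
    qed blast
  qed
qed

section \<open>Nested radicals as preimages\<close>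

text \<open>The elements of \<open>Qset\<close> are the nonnegative roots, whose outermost sign is
  still free. Supplying that sign turns a radical into a full fibre of \<open>qmap p\<close>, so
  adding one radical is one step backwards; the innermost radicand
  \<open>p\<^sup>2 + 2 p - 1\<close> is \<open>(p - 1) + p (p + 1)\<close>.\<close>

lemma Rset_eq_preim:
  assumes p: "p \<ge> 2"
  shows "Rset p (Suc n) = (\<lambda>y. real p - 1 + y) ` preim p (real p - 1) (Suc n)"
proof -
  have key: "{s * q | q s. q \<in> Qset p (Suc n) \<and> s \<in> {1, -1}} = preim p (real p - 1) (Suc n)"
  proof (induction n)
    case 0
    define r where "r = sqrt (real p ^ 2 + 2 * real p - 1)"
    have "real p ^ 2 + 2 * real p - 1 \<ge> 0" using p by (simp add: add_increasing)
    then have "y \<in> preim p (real p - 1) (Suc 0) \<longleftrightarrow> y\<^sup>2 = r\<^sup>2" for y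
      by (auto simp: r_def preim_def qmap_def power2_eq_square algebra_simps)
    then have "preim p (real p - 1) (Suc 0) = {r, - r}"
      unfolding power2_eq_iff by blast
    moreover have "{s * q | q s. q \<in> {r} \<and> s \<in> {1, -1}} = {r, - r}"
      by (auto intro: exI[of _ "-1"])
    ultimately show ?case by (simp only: Qset.simps r_def)
  next
    case (Suc n)
    have root: "y\<^sup>2 = real p ^ 2 + real p + u \<longleftrightarrow>
        y = sqrt (real p ^ 2 + real p + u) \<or> y = - sqrt (real p ^ 2 + real p + u)"
      if "u \<in> preim p (real p - 1) (Suc n)" for u y
    proof -
      have "u > - (real p * (real p + 1))"
        using critical_value_lt[OF p] preim_abs_le[OF that abs_center_le[OF p]] by blast
      then have "real p ^ 2 + real p + u = (sqrt (real p ^ 2 + real p + u))\<^sup>2"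
        by (simp add: power2_eq_square algebra_simps)
      then show ?thesis by (metis power2_eq_iff)
    qed
    have "Qset p (Suc (Suc n))
        = (\<lambda>u. sqrt (real p ^ 2 + real p + u)) ` {s * q | q s. q \<in> Qset p (Suc n) \<and> s \<in> {1, -1}}"
      by (auto simp: image_iff)
    then have Q: "Qset p (Suc (Suc n))
        = (\<lambda>u. sqrt (real p ^ 2 + real p + u)) ` preim p (real p - 1) (Suc n)"
      by (simp only: Suc)
    have "y \<in> preim p (real p - 1) (Suc (Suc n)) \<longleftrightarrow>
        (\<exists>u\<in>preim p (real p - 1) (Suc n). y\<^sup>2 = real p ^ 2 + real p + u)" for y
      unfolding preim_Suc[of _ _ "Suc n"]
      by (auto simp: qmap_def power2_eq_square algebra_simps
          intro!: bexI[of _ "qmap p y"])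
    then have "y \<in> preim p (real p - 1) (Suc (Suc n)) \<longleftrightarrow>
        (\<exists>q\<in>Qset p (Suc (Suc n)). y = 1 * q \<or> y = -1 * q)" for y
      unfolding Q using root by auto
    then show ?case by blast
  qed
  have "Rset p (Suc n) = (\<lambda>y. real p - 1 + y) ` {s * q | q s. q \<in> Qset p (Suc n) \<and> s \<in> {1, -1}}"
    unfolding Rset_def by blast
  then show ?thesis unfolding key .
qed

lemma points_eq_preims:
  assumes p: "p \<ge> 2"
  shows "{2 * (real p - 1)} \<union> (\<Union>n\<in>{1..}. Rset p n) = (\<lambda>y. real p - 1 + y) ` preims p"
proof -
  have "(\<Union>n\<in>{1..}. Rset p n) = (\<Union>n. Rset p (Suc n))"
    by (auto simp: image_iff) (metis Suc_le_D)+
  also have "\<dots> = (\<lambda>y. real p - 1 + y) ` (\<Union>n. preim p (real p - 1) (Suc n))"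
    by (auto simp: Rset_eq_preim[OF p])
  finally have "(\<Union>n\<in>{1..}. Rset p n) = \<dots>" .
  moreover have "preims p = preim p (real p - 1) 0 \<union> (\<Union>n. preim p (real p - 1) (Suc n))"
    unfolding preims_def by (subst UNIV_nat_eq) (simp only: UN_insert image_image)
  ultimately show ?thesis by (simp add: image_Un)
qed

lemma spec_set_eq:
  assumes p: "p \<ge> 2"
  shows "spec_set p = (\<lambda>y. real p - 1 + y) ` (julia p \<union> preims p)"
  unfolding spec_set_def points_eq_preims[OF p] closure_translation closure_preims[OF p] ..

section \<open>The adjacency operator on \<open>l2\<close>\<close>

definition scons :: "nat \<Rightarrow> (nat \<Rightarrow> nat) \<Rightarrow> nat \<Rightarrow> nat" where
  "scons a w = case_nat a w"

definition stl :: "(nat \<Rightarrow> nat) \<Rightarrow> nat \<Rightarrow> nat" where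
  "stl w n = w (Suc n)"

lemma scons_0 [simp]: "scons a w 0 = a"
  and scons_Suc [simp]: "scons a w (Suc n) = w n"
  and stl_scons [simp]: "stl (scons a w) = w"
  by (auto simp: scons_def stl_def)

lemma scons_stl [simp]: "scons (w 0) (stl w) = w"
  by (auto simp: scons_def stl_def split: nat.split)

lemma scons_eq_iff [simp]: "scons a u = scons b v \<longleftrightarrow> a = b \<and> u = v"
  by (metis scons_0 stl_scons)

lemma scons_cases: obtains a u where "w = scons a u"
  by (metis scons_stl)

text \<open>Recovers the recursion from the closed form: prepending a zero moves the first nonzero
  letter one place to the right, while any other first letter is itself the letter that
  \<open>LEAST\<close> finds.\<close>

lemma e_inf_scons:
  "e_inf i (scons a w) =
    (if a = 0 then scons i (e_inf i w) else if a = i then scons 0 w else scons a w)"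
proof (cases "a = 0")
  case False
  have L: "(LEAST k. scons a w k \<noteq> 0) = 0" using False by (intro Least_equality) auto
  show ?thesis using False
    by (auto simp: e_inf_def L Let_def fun_eq_iff scons_def split: nat.split)
next
  case True
  show ?thesis
  proof (cases "\<forall>n. w n = 0")
    case True
    then have "scons a w n = 0" for n using \<open>a = 0\<close> by (cases n) auto
    then show ?thesis using True \<open>a = 0\<close>
      by (auto simp: e_inf_def fun_eq_iff scons_def split: nat.split)
  next
    case False
    then obtain m where "w m \<noteq> 0" by blast
    then have L: "(LEAST k. scons a w k \<noteq> 0) = Suc (LEAST k. w k \<noteq> 0)"
      using \<open>a = 0\<close> by (subst Least_Suc[of _ "Suc m"]) auto
    have nz: "\<not> (\<forall>n. scons a w n = 0)" using \<open>w m \<noteq> 0\<close> by (metis scons_Suc)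
    define k where "k = (LEAST k. w k \<noteq> 0)"
    have E1: "e_inf i (scons a w) = (\<lambda>n. if n < Suc k then i
        else if n = Suc k then (if scons a w (Suc k) = i then 0 else scons a w (Suc k)) else scons a w n)"
      by (simp only: e_inf_def nz if_False Let_def L k_def)
    have E2: "e_inf i w = (\<lambda>n. if n < k then i else if n = k then (if w k = i then 0 else w k) else w n)"
      by (simp only: e_inf_def False if_False Let_def k_def)
    have "e_inf i (scons a w) n = scons i (e_inf i w) n" for n
      unfolding E1 E2 by (cases n) auto
    then show ?thesis using \<open>a = 0\<close> by auto
  qed
qed

lemma e_inf_inv_scons:
  "e_inf_inv i (scons a w) =
    (if a = i then scons 0 (e_inf_inv i w) else if a = 0 then scons i w else scons a w)"
proof (cases "a = i")
  case False
  have L: "(LEAST k. scons a w k \<noteq> i) = 0" using False by (intro Least_equality) auto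
  show ?thesis using False
    by (auto simp: e_inf_inv_def L Let_def fun_eq_iff scons_def split: nat.split)
next
  case True
  show ?thesis
  proof (cases "\<forall>n. w n = i")
    case True
    then have "scons a w n = i" for n using \<open>a = i\<close> by (cases n) auto
    then show ?thesis using True \<open>a = i\<close>
      by (auto simp: e_inf_inv_def fun_eq_iff scons_def split: nat.split)
  next
    case False
    then obtain m where "w m \<noteq> i" by blast
    then have L: "(LEAST k. scons a w k \<noteq> i) = Suc (LEAST k. w k \<noteq> i)"
      using \<open>a = i\<close> by (subst Least_Suc[of _ "Suc m"]) auto
    have nz: "\<not> (\<forall>n. scons a w n = i)" using \<open>w m \<noteq> i\<close> by (metis scons_Suc)
    define k where "k = (LEAST k. w k \<noteq> i)"
    have E1: "e_inf_inv i (scons a w) = (\<lambda>n. if n < Suc k then 0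
        else if n = Suc k then (if scons a w (Suc k) = 0 then i else scons a w (Suc k)) else scons a w n)"
      by (simp only: e_inf_inv_def nz if_False Let_def L k_def)
    have E2: "e_inf_inv i w = (\<lambda>n. if n < k then 0 else if n = k then (if w k = 0 then i else w k) else w n)"
      by (simp only: e_inf_inv_def False if_False Let_def k_def)
    have "e_inf_inv i (scons a w) n = scons 0 (e_inf_inv i w) n" for n
      unfolding E1 E2 by (cases n) auto
    then show ?thesis using \<open>a = i\<close> by auto
  qed
qed

text \<open>Infinite words are compared letter by letter: the induction is on the position, with the
  word generalised so that it may be replaced by its tail.\<close>

lemma e_inf_inv_e_inf: "i \<noteq> 0 \<Longrightarrow> e_inf_inv i (e_inf i w) = w"
proof -
  assume i: "i \<noteq> 0"
  have "e_inf_inv i (e_inf i w) n = w n" for n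
  proof (induction n arbitrary: w)
    case 0
    obtain a u where "w = scons a u" by (rule scons_cases)
    then show ?case using i by (simp add: e_inf_scons e_inf_inv_scons)
  next
    case (Suc n)
    obtain a u where "w = scons a u" by (rule scons_cases)
    then show ?case using i Suc[of u] by (simp add: e_inf_scons e_inf_inv_scons)
  qed
  then show ?thesis by blast
qed

lemma e_inf_e_inf_inv: "i \<noteq> 0 \<Longrightarrow> e_inf i (e_inf_inv i w) = w"
proof -
  assume i: "i \<noteq> 0"
  have "e_inf i (e_inf_inv i w) n = w n" for n
  proof (induction n arbitrary: w)
    case 0
    obtain a u where "w = scons a u" by (rule scons_cases)
    then show ?case using i by (simp add: e_inf_scons e_inf_inv_scons)
  next
    case (Suc n)
    obtain a u where "w = scons a u" by (rule scons_cases)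
    then show ?case using i Suc[of u] by (simp add: e_inf_scons e_inf_inv_scons)
  qed
  then show ?thesis by blast
qed

lemma e_inf_le: "i \<le> p \<Longrightarrow> \<forall>n. w n \<le> p \<Longrightarrow> e_inf i w n \<le> p"
  by (auto simp: e_inf_def Let_def)

lemma e_inf_inv_le: "i \<le> p \<Longrightarrow> \<forall>n. w n \<le> p \<Longrightarrow> e_inf_inv i w n \<le> p"
  by (auto simp: e_inf_inv_def Let_def)

section \<open>Closed vertex sets and the block form of the adjacency operator\<close>

text \<open>Takes the place of orbits in all inductions: this class is stable under passing to
  tails.\<close>

definition invariant :: "nat \<Rightarrow> (nat \<Rightarrow> nat) set \<Rightarrow> bool" where
  "invariant p V \<longleftrightarrow> (\<forall>v\<in>V. \<forall>n. v n \<le> p)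
     \<and> (\<forall>v\<in>V. \<forall>i\<in>{1..p}. e_inf i v \<in> V \<and> e_inf_inv i v \<in> V)"

definition tails :: "(nat \<Rightarrow> nat) set \<Rightarrow> (nat \<Rightarrow> nat) set" where
  "tails V = {u. scons 0 u \<in> V}"

lemma invariant_orbit:
  assumes w: "\<forall>n. w n \<le> p"
  shows "invariant p (orbit p w)"
proof -
  have "\<forall>n. v n \<le> p" if "v \<in> orbit p w" for v
  proof -
    have "(w, v) \<in> (gen_step p \<union> (gen_step p)\<inverse>)\<^sup>*" using that by (simp add: orbit_def)
    then show ?thesis
    proof (induction rule: rtrancl_induct)
      case (step u v)
      from step(2) obtain i where i: "i \<in> {1..p}" "v = e_inf i u \<or> u = e_inf i v"
        by (auto simp: gen_step_def)
      then have "v = e_inf i u \<or> v = e_inf_inv i u" using e_inf_inv_e_inf[of i v] by auto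
      then show ?case using i(1) step(3) e_inf_le e_inf_inv_le by auto
    qed (use w in simp)
  qed
  moreover have "e_inf i v \<in> orbit p w \<and> e_inf_inv i v \<in> orbit p w"
    if v: "v \<in> orbit p w" and i: "i \<in> {1..p}" for v i
  proof -
    have "(v, e_inf i v) \<in> gen_step p" "(e_inf_inv i v, v) \<in> gen_step p"
      using i e_inf_e_inf_inv[of i v] by (force simp: gen_step_def)+
    then show ?thesis using v unfolding orbit_def
      by (auto intro: rtrancl_into_rtrancl)
  qed
  ultimately show ?thesis by (auto simp: invariant_def)
qed

text \<open>\<open>e_inf a\<close> sends \<open>a u\<close> to \<open>0 u\<close>, and its inverse
  sends \<open>0 u\<close> back to \<open>a u\<close>, so a closed set is the product of the
  alphabet with its set of tails.\<close>

lemma scons_mem_iff: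
  assumes "invariant p V"
  shows "scons a u \<in> V \<longleftrightarrow> a \<le> p \<and> u \<in> tails V"
proof -
  have ap: "a \<le> p" if "scons a u \<in> V"
    using assms that unfolding invariant_def by (metis scons_0)
  show ?thesis
  proof (cases "a = 0")
    case False
    have *: "e_inf a v \<in> V \<and> e_inf_inv a v \<in> V" if "v \<in> V" "a \<le> p" for v
      using assms that False unfolding invariant_def by auto
    have "scons 0 u \<in> V" if "scons a u \<in> V"
      using *[OF that ap[OF that]] False by (simp add: e_inf_scons)
    moreover have "scons a u \<in> V" if "scons 0 u \<in> V" "a \<le> p"
      using *[OF that] False by (simp add: e_inf_inv_scons)
    ultimately show ?thesis using ap by (auto simp: tails_def)
  qed (simp add: tails_def)
qed

lemma invariant_tails:
  assumes V: "invariant p V"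
  shows "invariant p (tails V)"
proof -
  have "e_inf i u \<in> tails V \<and> e_inf_inv i u \<in> tails V" if u: "u \<in> tails V" and i: "i \<in> {1..p}" for u i
  proof -
    have "scons 0 u \<in> V" "scons i u \<in> V" using u i by (auto simp: scons_mem_iff[OF V])
    then have "e_inf i (scons 0 u) \<in> V" "e_inf_inv i (scons i u) \<in> V"
      using V i by (auto simp: invariant_def)
    then show ?thesis using i by (auto simp: e_inf_scons e_inf_inv_scons scons_mem_iff[OF V])
  qed
  moreover have "u n \<le> p" if "u \<in> tails V" for u n
  proof -
    have "scons 0 u (Suc n) \<le> p" using that V unfolding tails_def invariant_def by blast
    then show ?thesis by simp
  qed
  ultimately show ?thesis by (auto simp: invariant_def)
qed

lemma tails_nonempty:
  assumes "invariant p V" "V \<noteq> {}"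
  shows "tails V \<noteq> {}"
  using assms by (metis all_not_in_conv scons_mem_iff scons_stl)

lemma adj_scons_0:
  assumes "invariant p V" "u \<in> tails V"
  shows "adj p V f (scons 0 u) = (\<Sum>i\<in>{1..p}. f (scons i (e_inf i u)) + f (scons i u))"
proof -
  have "scons 0 u \<in> V" using assms by (simp add: scons_mem_iff)
  then show ?thesis
    by (auto simp: adj_def e_inf_scons e_inf_inv_scons intro!: sum.cong)
qed

text \<open>Only \<open>e_a\<close> moves a word that starts with \<open>a \<noteq> 0\<close>. The
  other \<open>p - 1\<close> generators fix it, and each of these loops contributes 2 to the
  diagonal.\<close>

lemma adj_scons:
  assumes "invariant p V" "u \<in> tails V" "a \<in> {1..p}"
  shows "adj p V f (scons a u)
    = f (scons 0 u) + f (scons 0 (e_inf_inv a u)) + 2 * (of_nat p - 1) * f (scons a u)"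
proof -
  let ?g = "\<lambda>i. f (e_inf i (scons a u)) + f (e_inf_inv i (scons a u))"
  have "scons a u \<in> V" using assms by (simp add: scons_mem_iff)
  then have "adj p V f (scons a u) = sum ?g {1..p}" by (simp add: adj_def)
  also have "\<dots> = ?g a + sum ?g ({1..p} - {a})"
    using assms(3) by (intro sum.remove) auto
  also have "sum ?g ({1..p} - {a}) = (\<Sum>i\<in>{1..p} - {a}. 2 * f (scons a u))"
    using assms(3) by (intro sum.cong) (auto simp: e_inf_scons e_inf_inv_scons)
  also have "\<dots> = 2 * (of_nat p - 1) * f (scons a u)"
    using assms(3) by (simp add: of_nat_diff)
  also have "?g a = f (scons 0 u) + f (scons 0 (e_inf_inv a u))"
    using assms(3) by (simp add: e_inf_scons e_inf_inv_scons)
  finally show ?thesis .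
qed

section \<open>Norm bounds through finite subsets\<close>

text \<open>Membership in \<open>l2 V\<close> together with the norm bound \<open>c\<close>, phrased
  by finite partial norms, so that the triangle inequality and limits are handled on finite
  sets.\<close>

definition l2b :: "(nat \<Rightarrow> nat) set \<Rightarrow> ((nat \<Rightarrow> nat) \<Rightarrow> complex) \<Rightarrow> real \<Rightarrow> bool" where
  "l2b V f c \<longleftrightarrow> (\<forall>v. v \<notin> V \<longrightarrow> f v = 0)
     \<and> (\<forall>F. finite F \<and> F \<subseteq> V \<longrightarrow> L2_set (\<lambda>v. cmod (f v)) F \<le> c)"

lemma l2b_nonneg: "l2b V f c \<Longrightarrow> c \<ge> 0"
  unfolding l2b_def by (metis L2_set_empty empty_subsetI finite.emptyI)

lemma l2b_iff: "l2b V f c \<longleftrightarrow> f \<in> l2 V \<and> l2norm V f \<le> c"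
proof
  assume f: "l2b V f c"
  have c: "c \<ge> 0" by (rule l2b_nonneg[OF f])
  have le: "(\<Sum>v\<in>F. (cmod (f v))\<^sup>2) \<le> c\<^sup>2" if "finite F" "F \<subseteq> V" for F
  proof -
    have "L2_set (\<lambda>v. cmod (f v)) F \<le> c" using f that by (simp add: l2b_def)
    then have "sqrt (\<Sum>v\<in>F. (cmod (f v))\<^sup>2) \<le> sqrt (c\<^sup>2)" using c by (simp add: L2_set_def)
    then show ?thesis by (simp only: real_sqrt_le_iff)
  qed
  have s: "(\<lambda>v. (cmod (f v))\<^sup>2) summable_on V"
    using le by (intro nonneg_bdd_above_summable_on bdd_aboveI[of _ "c\<^sup>2"]) auto
  have "infsum (\<lambda>v. (cmod (f v))\<^sup>2) V \<le> c\<^sup>2"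
    using le s by (intro infsum_le_finite_sums) auto
  then have "l2norm V f \<le> c" using c unfolding l2norm_def by (simp add: real_le_lsqrt)
  then show "f \<in> l2 V \<and> l2norm V f \<le> c" using s f by (simp add: l2_def l2b_def)
next
  assume f: "f \<in> l2 V \<and> l2norm V f \<le> c"
  have "L2_set (\<lambda>v. cmod (f v)) F \<le> c" if "finite F" "F \<subseteq> V" for F
  proof -
    have "(\<Sum>v\<in>F. (cmod (f v))\<^sup>2) \<le> infsum (\<lambda>v. (cmod (f v))\<^sup>2) V"
      using f that by (intro finite_sum_le_infsum) (auto simp: l2_def)
    then have "L2_set (\<lambda>v. cmod (f v)) F \<le> l2norm V f"
      by (simp add: L2_set_def l2norm_def)
    then show ?thesis using f by simp
  qed
  then show "l2b V f c" using f by (simp add: l2b_def l2_def)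
qed

lemma l2b_l2norm: "f \<in> l2 V \<Longrightarrow> l2b V f (l2norm V f)"
  by (simp add: l2b_iff)

lemma l2b_cmod_le: "l2b V f c \<Longrightarrow> cmod (f v) \<le> c"
proof (cases "v \<in> V")
  case True
  assume "l2b V f c"
  then have "L2_set (\<lambda>v. cmod (f v)) {v} \<le> c" using True unfolding l2b_def by blast
  then show ?thesis by (simp add: L2_set_def)
qed (use l2b_nonneg in \<open>auto simp: l2b_def\<close>)

lemma l2b_add:
  assumes "l2b V f a" "l2b V g b"
  shows "l2b V (\<lambda>v. f v + g v) (a + b)"
proof -
  have "L2_set (\<lambda>v. cmod (f v + g v)) F \<le> a + b" if "finite F" "F \<subseteq> V" for F
  proof -
    have "L2_set (\<lambda>v. cmod (f v + g v)) F \<le> L2_set (\<lambda>v. cmod (f v) + cmod (g v)) F"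
      by (intro L2_set_mono norm_triangle_ineq norm_ge_zero)
    also have "\<dots> \<le> L2_set (\<lambda>v. cmod (f v)) F + L2_set (\<lambda>v. cmod (g v)) F"
      by (rule L2_set_triangle_ineq)
    also have "\<dots> \<le> a + b" using assms that unfolding l2b_def by (intro add_mono) auto
    finally show ?thesis .
  qed
  then show ?thesis using assms by (auto simp: l2b_def)
qed

lemma l2b_scale:
  assumes "l2b V f a"
  shows "l2b V (\<lambda>v. c * f v) (cmod c * a)"
proof -
  have "L2_set (\<lambda>v. cmod (c * f v)) F \<le> cmod c * a" if "finite F" "F \<subseteq> V" for F
  proof -
    have "L2_set (\<lambda>v. cmod (c * f v)) F = cmod c * L2_set (\<lambda>v. cmod (f v)) F"
      by (simp add: L2_set_right_distrib norm_mult)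
    then show ?thesis using assms that by (simp add: l2b_def mult_left_mono)
  qed
  then show ?thesis using assms by (auto simp: l2b_def)
qed

lemma l2b_diff:
  assumes "l2b V f a" "l2b V g b"
  shows "l2b V (\<lambda>v. f v - g v) (a + b)"
  using l2b_add[OF assms(1) l2b_scale[OF assms(2), of "-1"]] by simp

lemma l2b_zero: "l2b V (\<lambda>v. 0) 0"
  by (simp add: l2b_def L2_set_def)

lemma l2b_sum:
  assumes "finite I" "\<And>i. i \<in> I \<Longrightarrow> l2b V (f i) (c i)"
  shows "l2b V (\<lambda>v. \<Sum>i\<in>I. f i v) (\<Sum>i\<in>I. c i)"
  using assms by (induction I rule: finite_induct) (auto simp: l2b_zero intro: l2b_add)

lemma l2b_0_iff: "l2b V f 0 \<longleftrightarrow> f = (\<lambda>v. 0)"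
  using l2b_cmod_le[of V f 0] l2b_zero by fastforce

text \<open>Restriction to a first letter, prepending or removing a letter and the action of a
  generator are all pullbacks along an injection, extended by zero; none of them increases the
  norm.\<close>

lemma l2b_comp:
  assumes f: "l2b W f c" and D: "D \<subseteq> V" "inj_on \<phi> D" "\<phi> ` D \<subseteq> W"
  shows "l2b V (\<lambda>v. if v \<in> D then f (\<phi> v) else 0) c"
proof -
  have "L2_set (\<lambda>v. cmod (if v \<in> D then f (\<phi> v) else 0)) F \<le> c" if F: "finite F" "F \<subseteq> V" for F
  proof -
    have "(\<Sum>v\<in>F. (cmod (if v \<in> D then f (\<phi> v) else 0))\<^sup>2) = (\<Sum>v\<in>F \<inter> D. (cmod (f (\<phi> v)))\<^sup>2)"
      using F by (intro sum.mono_neutral_cong_right) auto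
    also have "\<dots> = (\<Sum>w\<in>\<phi> ` (F \<inter> D). (cmod (f w))\<^sup>2)"
      using D by (subst sum.reindex) (auto intro: inj_on_subset)
    finally have "L2_set (\<lambda>v. cmod (if v \<in> D then f (\<phi> v) else 0)) F
        = L2_set (\<lambda>w. cmod (f w)) (\<phi> ` (F \<inter> D))"
      by (simp add: L2_set_def)
    also have "\<dots> \<le> c"
    proof -
      have "\<phi> ` (F \<inter> D) \<subseteq> W" using D(3) by auto
      then show ?thesis using f F(1) by (simp add: l2b_def)
    qed
    finally show ?thesis .
  qed
  then show ?thesis using D by (auto simp: l2b_def)
qed

text \<open>The series is summed pointwise. On a finite set the norm is continuous in the finitely
  many values, so the bounds for partial sums pass to the limit.\<close>

lemma l2b_suminf:
  assumes g: "\<And>k. l2b V (g k) (b k)" and b: "summable b"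
  shows "summable (\<lambda>k. g k v)" "l2b V (\<lambda>v. \<Sum>k. g k v) (suminf b)"
proof -
  show s: "summable (\<lambda>k. g k v)" for v
    using l2b_cmod_le[OF g] by (intro summable_comparison_test[OF _ b]) auto
  have "L2_set (\<lambda>v. cmod (\<Sum>k. g k v)) F \<le> suminf b" if F: "finite F" "F \<subseteq> V" for F
  proof (rule LIMSEQ_le_const2)
    show "(\<lambda>n. L2_set (\<lambda>v. cmod (\<Sum>k<n. g k v)) F) \<longlonglongrightarrow> L2_set (\<lambda>v. cmod (\<Sum>k. g k v)) F"
      unfolding L2_set_def by (intro tendsto_intros summable_LIMSEQ s)
    have "L2_set (\<lambda>v. cmod (\<Sum>k<n. g k v)) F \<le> suminf b" for n
    proof -
      have "l2b V (\<lambda>v. \<Sum>k<n. g k v) (\<Sum>k<n. b k)" using g by (intro l2b_sum) auto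
      then have "L2_set (\<lambda>v. cmod (\<Sum>k<n. g k v)) F \<le> (\<Sum>k<n. b k)"
        using F unfolding l2b_def by blast
      also have "\<dots> \<le> suminf b" using l2b_nonneg[OF g] by (intro sum_le_suminf b) auto
      finally show ?thesis .
    qed
    then show "\<exists>N. \<forall>n\<ge>N. L2_set (\<lambda>v. cmod (\<Sum>k<n. g k v)) F \<le> suminf b" by blast
  qed
  moreover have "(\<Sum>k. g k v) = 0" if "v \<notin> V" for v
    using g that by (simp add: l2b_def)
  ultimately show "l2b V (\<lambda>v. \<Sum>k. g k v) (suminf b)" by (auto simp: l2b_def)
qed

lemma inj_on_e_inf: "i \<noteq> 0 \<Longrightarrow> inj_on (e_inf i) S"
  by (metis e_inf_inv_e_inf inj_onI)

lemma inj_on_e_inf_inv: "i \<noteq> 0 \<Longrightarrow> inj_on (e_inf_inv i) S"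
  by (metis e_inf_e_inf_inv inj_onI)

lemma l2b_adj:
  assumes V: "invariant p V" and f: "l2b V f c"
  shows "l2b V (adj p V f) (2 * real p * c)"
proof -
  have "l2b V (\<lambda>v. \<Sum>i\<in>{1..p}. (if v \<in> V then f (e_inf i v) else 0)
      + (if v \<in> V then f (e_inf_inv i v) else 0)) (\<Sum>i\<in>{1..p}. c + c)"
    using V by (intro l2b_sum l2b_add l2b_comp[OF f])
      (auto simp: invariant_def intro: inj_on_e_inf inj_on_e_inf_inv)
  moreover have "adj p V f = (\<lambda>v. \<Sum>i\<in>{1..p}. (if v \<in> V then f (e_inf i v) else 0)
      + (if v \<in> V then f (e_inf_inv i v) else 0))"
    by (auto simp: adj_def fun_eq_iff)
  ultimately show ?thesis by (simp add: mult_ac)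
qed

section \<open>Bounded invertibility and the Neumann series\<close>

text \<open>Solvability with a uniform bound plus uniqueness. Both can be transported through the
  Schur complement equation by equation; an inverse operator is chosen only when the definition of
  \<open>spec\<close> is reached.\<close>

definition invertible_at :: "nat \<Rightarrow> (nat \<Rightarrow> nat) set \<Rightarrow> complex \<Rightarrow> bool" where
  "invertible_at p V z \<longleftrightarrow>
     (\<exists>C. \<forall>h c. l2b V h c \<longrightarrow> (\<exists>f. l2b V f (C * c) \<and> (\<lambda>v. adj p V f v - z * f v) = h))
   \<and> (\<forall>f c. l2b V f c \<longrightarrow> (\<lambda>v. adj p V f v - z * f v) = (\<lambda>v. 0) \<longrightarrow> f = (\<lambda>v. 0))"

lemma adj_diff: "adj p V (\<lambda>v. f v - g v) v = adj p V f v - adj p V g v"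
  by (simp add: adj_def sum_subtractf sum.distrib)

lemma not_in_spec_if_invertible_at:
  assumes V: "invariant p V" and inv: "invertible_at p V z"
  shows "z \<notin> spec p V"
proof -
  define S where "S f = (\<lambda>v. adj p V f v - z * f v)" for f
  from inv obtain C where C: "\<And>h c. l2b V h c \<Longrightarrow> \<exists>f. l2b V f (C * c) \<and> S f = h"
    and inj: "\<And>f c. l2b V f c \<Longrightarrow> S f = (\<lambda>v. 0) \<Longrightarrow> f = (\<lambda>v. 0)"
    unfolding invertible_at_def S_def by blast
  define B where "B h = (SOME f. l2b V f (C * l2norm V h) \<and> S f = h)" for h
  have B: "l2b V (B h) (C * l2norm V h) \<and> S (B h) = h" if "h \<in> l2 V" for h
    unfolding B_def using C[OF l2b_l2norm[OF that]] by (rule someI_ex)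
  have S_l2: "S f \<in> l2 V" if "f \<in> l2 V" for f
    using l2b_diff[OF l2b_adj[OF V l2b_l2norm[OF that]] l2b_scale[OF l2b_l2norm[OF that]]]
    unfolding l2b_iff S_def by blast
  have BS: "B (S f) = f" if f: "f \<in> l2 V" for f
  proof -
    have b: "l2b V (B (S f)) (C * l2norm V (S f))" "S (B (S f)) = S f"
      using B[OF S_l2[OF f]] by auto
    from l2b_diff[OF b(1) l2b_l2norm[OF f]]
    have "(\<lambda>v. B (S f) v - f v) = (\<lambda>v. 0)"
    proof (rule inj)
      show "S (\<lambda>v. B (S f) v - f v) = (\<lambda>v. 0)"
        using fun_cong[OF b(2)] by (auto simp: S_def adj_diff algebra_simps)
    qed
    then show ?thesis by (auto simp: fun_eq_iff)
  qed
  have "(\<forall>f\<in>l2 V. B f \<in> l2 V \<and> B (S f) = f \<and> S (B f) = f)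
      \<and> (\<exists>C. \<forall>f\<in>l2 V. l2norm V (B f) \<le> C * l2norm V f)"
    using B BS unfolding l2b_iff by blast
  then show ?thesis unfolding spec_def S_def by blast
qed

text \<open>\<open>2 p\<close> bounds the operator norm, so the Neumann series converges. Uniqueness
  is the same norm estimate applied to an eigenfunction.\<close>

lemma invertible_at_large:
  assumes V: "invariant p V" and z: "cmod z > 2 * real p"
  shows "invertible_at p V z"
proof -
  have z0: "cmod z > 0" "z \<noteq> 0" using z by auto
  define q where "q = 2 * real p / cmod z"
  have q: "0 \<le> q" "q < 1" using z z0 by (auto simp: q_def)
  have ex: "\<exists>f. l2b V f (1 / (cmod z * (1 - q)) * c) \<and> (\<lambda>v. adj p V f v - z * f v) = h"
    if h: "l2b V h c" for h c
  proof -
    define g where "g k v = (adj p V ^^ k) h v / z ^ Suc k" for k v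
    have bh: "l2b V ((adj p V ^^ k) h) ((2 * real p) ^ k * c)" for k
    proof (induction k)
      case (Suc k)
      from l2b_adj[OF V this] show ?case by (simp add: mult_ac)
    qed (simp add: h)
    have bg: "l2b V (g k) (c / cmod z * q ^ k)" for k
      using l2b_scale[OF bh[of k], of "1 / z ^ Suc k"]
      by (simp add: g_def[abs_def] q_def norm_divide norm_mult norm_power power_divide mult_ac)
    have sb: "summable (\<lambda>k. c / cmod z * q ^ k)"
      using q by (intro summable_mult summable_geometric) auto
    have suminf_b: "(\<Sum>k. c / cmod z * q ^ k) = 1 / (cmod z * (1 - q)) * c"
      using q suminf_mult[OF summable_geometric[of q], of "c / cmod z"] suminf_geometric[of q] by simp
    define s where "s v = (\<Sum>k. g k v)" for v
    have gs: "(\<lambda>k. g k v) sums s v" for v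
      using l2b_suminf(1)[OF bg sb] by (simp add: s_def summable_sums)
    have ls: "l2b V s (1 / (cmod z * (1 - q)) * c)"
      using l2b_suminf(2)[OF bg sb] unfolding suminf_b s_def[abs_def] .
    have adj_g: "adj p V (g k) v = z * g (Suc k) v" for k v
    proof -
      have "adj p V (g k) v = adj p V ((adj p V ^^ k) h) v / z ^ Suc k"
        by (simp add: adj_def g_def[abs_def] sum_divide_distrib add_divide_distrib)
      then show ?thesis using z0 by (simp add: g_def)
    qed
    \<comment> \<open>At each vertex the operator is a finite sum, so it may be applied to the
      pointwise series term by term; the series shifts by one index and loses its first
      term.\<close>
    have adj_s: "adj p V s v = z * (s v - g 0 v)" for v
    proof (rule sums_unique2)
      show "(\<lambda>k. adj p V (g k) v) sums adj p V s v"
        unfolding adj_def by (auto intro!: sums_sum sums_add gs)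
      show "(\<lambda>k. adj p V (g k) v) sums (z * (s v - g 0 v))"
        unfolding adj_g using gs[of v] by (intro sums_mult) (simp add: sums_Suc_iff[of "\<lambda>k. g k v"])
    qed
    \<comment> \<open>The series solves the equation for \<open>z - A\<close>, whereas a solution
      for \<open>A - z\<close> is wanted.\<close>
    have "l2b V (\<lambda>v. - 1 * s v) (1 / (cmod z * (1 - q)) * c)"
      using l2b_scale[OF ls, of "-1"] by simp
    moreover have "adj p V (\<lambda>v. - 1 * s v) v = - adj p V s v" for v
      by (simp add: adj_def sum_negf sum.distrib sum_subtractf)
    then have "(\<lambda>v. adj p V (\<lambda>v. - 1 * s v) v - z * (- 1 * s v)) = h"
      using z0 by (auto simp: adj_s g_def algebra_simps)
    ultimately show ?thesis by blast
  qed
  moreover have "f = (\<lambda>v. 0)" if f: "l2b V f c" and 0: "(\<lambda>v. adj p V f v - z * f v) = (\<lambda>v. 0)" for f c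
  proof -
    have "adj p V f = (\<lambda>v. z * f v)" using fun_cong[OF 0] by auto
    moreover have fl: "f \<in> l2 V" using f by (simp add: l2b_iff)
    ultimately have "l2b V (\<lambda>v. z * f v) (2 * real p * l2norm V f)"
      using l2b_adj[OF V l2b_l2norm] by metis
    from l2b_scale[OF this, of "1 / z"]
    have "l2b V f (2 * real p * l2norm V f / cmod z)"
      using z0 by (simp add: norm_divide)
    then have "l2norm V f \<le> 2 * real p * l2norm V f / cmod z" by (simp add: l2b_iff)
    then have "(cmod z - 2 * real p) * l2norm V f \<le> 0"
      using z0(1) by (simp add: pos_le_divide_eq algebra_simps)
    then have "l2norm V f \<le> 0" using z by (simp add: mult_le_0_iff)
    then show "f = (\<lambda>v. 0)" using fl l2b_0_iff[of V f] by (simp add: l2b_iff)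
  qed
  ultimately show ?thesis unfolding invertible_at_def by blast
qed

section \<open>The Schur complement onto the letter 0\<close>

text \<open>The equations at the letters \<open>a \<ge> 1\<close> are substituted into the equation
  at the letter 0. Each generator contributes \<open>(1 + e_i) (1 + e_i\<inverse>)\<close>, which
  gives the adjacency operator of the tails plus \<open>2 p\<close>. Everything is multiplied by
  \<open>m = y - (p - 1)\<close> rather than divided, so the identity serves both for constructing
  solutions and for analysing kernel elements.\<close>

lemma schur_equations:
  assumes V: "invariant p V" and u: "u \<in> tails V"
    and a: "\<And>a v. a \<in> {1..p} \<Longrightarrow> v \<in> tails V \<Longrightarrow>
      (y - (of_nat p - 1)) * f (scons a v) = f (scons 0 v) + f (scons 0 (e_inf_inv a v)) - h (scons a v)"
    and f': "f' = (\<lambda>u. if u \<in> tails V then f (scons 0 u) else 0)"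
  shows "(y - (of_nat p - 1)) * (adj p V f (scons 0 u) - (y + of_nat p - 1) * f (scons 0 u))
    = adj p (tails V) f' u - (qmap p y + of_nat p - 1) * f' u
      - (\<Sum>i\<in>{1..p}. h (scons i (e_inf i u)) + h (scons i u))"
proof -
  let ?m = "y - (of_nat p - 1)"
  have V': "invariant p (tails V)" by (rule invariant_tails[OF V])
  have mem: "e_inf i u \<in> tails V" "e_inf_inv i u \<in> tails V" if "i \<in> {1..p}" for i
    using V' u that by (auto simp: invariant_def)
  have "?m * adj p V f (scons 0 u)
      = (\<Sum>i\<in>{1..p}. ?m * f (scons i (e_inf i u)) + ?m * f (scons i u))"
    by (simp add: adj_scons_0[OF V u] sum_distrib_left distrib_left)
  also have "\<dots> = (\<Sum>i\<in>{1..p}. (f' (e_inf i u) + f' (e_inf_inv i u)) + 2 * f' u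
      - (h (scons i (e_inf i u)) + h (scons i u)))"
    using u mem a[OF _ u] a[OF _ mem(1)]
    by (intro sum.cong refl) (simp add: f' e_inf_inv_e_inf)
  also have "\<dots> = adj p (tails V) f' u + 2 * of_nat p * f' u
      - (\<Sum>i\<in>{1..p}. h (scons i (e_inf i u)) + h (scons i u))"
    using u by (simp add: adj_def sum.distrib sum_subtractf)
  finally show ?thesis
    using u by (simp add: f' qmap_def power2_eq_square algebra_simps)
qed

text \<open>Back substitution: \<open>f\<close> is the component at the letter 0, and the components
  at the other letters are read off from their own equations with right-hand side
  \<open>h\<close>.\<close>

definition schur_lift :: "(nat \<Rightarrow> nat) set \<Rightarrow> complex \<Rightarrow> ((nat \<Rightarrow> nat) \<Rightarrow> complex)
    \<Rightarrow> ((nat \<Rightarrow> nat) \<Rightarrow> complex) \<Rightarrow> (nat \<Rightarrow> nat) \<Rightarrow> complex" where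
  "schur_lift V m h f v = (if v \<notin> V then 0 else if v 0 = 0 then f (stl v)
     else 1 / m * (f (stl v) + f (e_inf_inv (v 0) (stl v)) - h v))"

lemma invariant_split:
  assumes "invariant p V" "v \<in> V"
  obtains a u where "v = scons a u" "a \<le> p" "u \<in> tails V"
  using assms by (metis scons_mem_iff scons_stl)

lemma l2b_schur_lift:
  assumes V: "invariant p V" and h: "l2b V h c" and f: "l2b (tails V) f d"
  shows "l2b V (schur_lift V m h f) (d + real p * (cmod (1 / m) * (d + d + c)))"
proof -
  have V': "invariant p (tails V)" by (rule invariant_tails[OF V])
  define D where "D i = {v \<in> V. v 0 = i}" for i :: nat
  have stl_mem: "stl v \<in> tails V" "v 0 \<le> p" if "v \<in> V" for v
    using that scons_mem_iff[OF V, of "v 0" "stl v"] by auto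
  \<comment> \<open>At most one summand is nonzero, the one of the first letter of \<open>v\<close>.
    Written this way, the lift is a finite combination of pullbacks along injections, to which the
    norm rules apply.\<close>
  have sum: "schur_lift V m h f v = (if v \<in> D 0 then f (stl v) else 0)
     + (\<Sum>i\<in>{1..p}. 1 / m * (((if v \<in> D i then f (stl v) else 0)
         + (if v \<in> D i then f (e_inf_inv i (stl v)) else 0)) - (if v \<in> D i then h v else 0)))" for v
  proof (cases "v \<in> V \<and> v 0 \<noteq> 0")
    case True
    have "(\<Sum>i\<in>{1..p}. 1 / m * (((if v \<in> D i then f (stl v) else 0)
         + (if v \<in> D i then f (e_inf_inv i (stl v)) else 0)) - (if v \<in> D i then h v else 0)))
      = (\<Sum>i\<in>{1..p}. if i = v 0 then 1 / m * (f (stl v) + f (e_inf_inv i (stl v)) - h v) else 0)"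
      using True by (intro sum.cong) (auto simp: D_def)
    also have "\<dots> = schur_lift V m h f v" using True stl_mem(2)[of v] by (simp add: schur_lift_def)
    finally show ?thesis using True by (simp add: D_def)
  next
    case False
    then have "v \<notin> D i" if "i \<in> {1..p}" for i using that by (auto simp: D_def)
    then show ?thesis using False by (auto simp: schur_lift_def D_def)
  qed
  have DV: "D i \<subseteq> V" for i by (auto simp: D_def)
  have injD: "inj_on stl (D i)" for i
    by (auto simp: D_def inj_on_def) (metis scons_stl)
  have stlD: "stl ` D i \<subseteq> tails V" for i using stl_mem by (auto simp: D_def)
  have pushe: "l2b V (\<lambda>v. if v \<in> D i then f (e_inf_inv i (stl v)) else 0) d"
    if "i \<in> {1..p}" for i
  proof (rule l2b_comp[OF f DV, where \<phi> = "\<lambda>v. e_inf_inv i (stl v)"])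
    show "inj_on (\<lambda>v. e_inf_inv i (stl v)) (D i)"
      using that comp_inj_on[OF injD[of i] inj_on_e_inf_inv[of i]] by (simp add: comp_def)
    show "(\<lambda>v. e_inf_inv i (stl v)) ` D i \<subseteq> tails V"
      using stlD[of i] V' that by (auto simp: invariant_def)
  qed
  have pushh: "l2b V (\<lambda>v. if v \<in> D i then h v else 0) c" for i
    using l2b_comp[OF h DV, of "\<lambda>v. v" i] DV by (simp add: inj_on_def)
  have "l2b V (schur_lift V m h f) (d + (\<Sum>i\<in>{1..p}. cmod (1 / m) * ((d + d) + c)))"
    unfolding sum[abs_def]
    by (intro l2b_add l2b_sum l2b_scale l2b_diff pushe pushh l2b_comp[OF f DV injD stlD]) auto
  then show ?thesis by simp
qed

text \<open>At nonzero letters the equation holds by construction; at the letter 0 it is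
  \<open>eq\<close> after cancelling the nonzero factor \<open>m\<close>.\<close>

lemma schur_lift_solves:
  assumes V: "invariant p V" and y: "y \<noteq> of_nat p - 1"
    and h: "\<And>v. v \<notin> V \<Longrightarrow> h v = 0" and f: "\<And>u. u \<notin> tails V \<Longrightarrow> f u = 0"
    and eq: "\<And>u. u \<in> tails V \<Longrightarrow>
      adj p (tails V) f u - (qmap p y + of_nat p - 1) * f u
      = (y - (of_nat p - 1)) * h (scons 0 u) + (\<Sum>i\<in>{1..p}. h (scons i (e_inf i u)) + h (scons i u))"
  defines "g \<equiv> schur_lift V (y - (of_nat p - 1)) h f"
  shows "adj p V g v - (y + of_nat p - 1) * g v = h v"
proof (cases "v \<in> V")
  case False
  then show ?thesis using h by (simp add: adj_def g_def schur_lift_def)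
next
  case True
  define m where "m = y - (of_nat p - 1)"
  have m: "m \<noteq> 0" using y by (simp add: m_def)
  have V': "invariant p (tails V)" by (rule invariant_tails[OF V])
  have memV: "scons a u \<in> V" if "a \<le> p" "u \<in> tails V" for a u
    using that by (simp add: scons_mem_iff[OF V])
  have g_a: "m * g (scons a v) = g (scons 0 v) + g (scons 0 (e_inf_inv a v)) - h (scons a v)"
    if "a \<in> {1..p}" "v \<in> tails V" for a v
  proof -
    have "e_inf_inv a v \<in> tails V" using that V' by (auto simp: invariant_def)
    then show ?thesis using that m memV by (simp add: g_def schur_lift_def flip: m_def)
  qed
  have f_eq: "f = (\<lambda>u. if u \<in> tails V then g (scons 0 u) else 0)"
    using f memV by (auto simp: g_def schur_lift_def fun_eq_iff)
  obtain a u where v: "v = scons a u" and a: "a \<le> p" and u: "u \<in> tails V"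
    using invariant_split[OF V True] .
  show ?thesis
  proof (cases "a = 0")
    case True
    have "m * (adj p V g (scons 0 u) - (y + of_nat p - 1) * g (scons 0 u))
      = adj p (tails V) f u - (qmap p y + of_nat p - 1) * f u
        - (\<Sum>i\<in>{1..p}. h (scons i (e_inf i u)) + h (scons i u))"
      unfolding m_def by (rule schur_equations[OF V u _ f_eq]) (use g_a m_def in auto)
    also have "\<dots> = m * h (scons 0 u)" by (simp add: eq[OF u] m_def)
    finally show ?thesis using m v True by simp
  next
    case False
    then have "a \<in> {1..p}" using a by auto
    then have "adj p V g v - (y + of_nat p - 1) * g v
        = g (scons 0 u) + g (scons 0 (e_inf_inv a u)) - m * g (scons a u)"
      unfolding v by (simp add: adj_scons[OF V u] m_def algebra_simps)
    then show ?thesis using g_a[OF \<open>a \<in> {1..p}\<close> u] by (simp add: v)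
  qed
qed

text \<open>Existence comes from lifting a solution on the tails. For uniqueness, a kernel element
  restricts on the letter 0 to a kernel element of the renormalised operator, hence vanishes there,
  and then \<open>m \<noteq> 0\<close> makes it vanish at all other letters.\<close>

lemma invertible_at_step:
  assumes V: "invariant p V" and y: "y \<noteq> of_nat p - 1"
    and inv: "invertible_at p (tails V) (qmap p y + of_nat p - 1)"
  shows "invertible_at p V (y + of_nat p - 1)"
proof -
  define m where "m = y - (of_nat p - 1)"
  have m: "m \<noteq> 0" using y by (simp add: m_def)
  have V': "invariant p (tails V)" by (rule invariant_tails[OF V])
  have memV: "scons a u \<in> V" if "a \<le> p" "u \<in> tails V" for a u
    using that by (simp add: scons_mem_iff[OF V])
  from inv obtain C where
    C: "\<And>h c. l2b (tails V) h c \<Longrightarrow> \<exists>f. l2b (tails V) f (C * c)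
         \<and> (\<lambda>v. adj p (tails V) f v - (qmap p y + of_nat p - 1) * f v) = h"
    and inj: "\<And>f c. l2b (tails V) f c \<Longrightarrow>
         (\<lambda>v. adj p (tails V) f v - (qmap p y + of_nat p - 1) * f v) = (\<lambda>v. 0) \<Longrightarrow> f = (\<lambda>v. 0)"
    unfolding invertible_at_def by blast
  have pull: "l2b (tails V) (\<lambda>u. if u \<in> tails V then h (scons a (\<psi> u)) else 0) c"
    if "l2b V h c" "a \<le> p" "inj_on \<psi> (tails V)" "\<psi> ` tails V \<subseteq> tails V" for h a \<psi> c
  proof -
    have "inj_on (\<lambda>u. scons a (\<psi> u)) (tails V)" using that(3) by (auto simp: inj_on_def)
    then show ?thesis using that memV
      by (intro l2b_comp[OF that(1), where \<phi> = "\<lambda>u. scons a (\<psi> u)"]) auto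
  qed
  \<comment> \<open>Norm factor of the component at the letter 0: the reduced right-hand side
    \<open>k\<close> consists of \<open>m\<close> times one block of \<open>h\<close> and
    \<open>2 p\<close> further pullbacks of \<open>h\<close>.\<close>
  define K where "K = C * (cmod m + 2 * real p)"
  have "\<exists>f. l2b V f ((K + real p * (cmod (1 / m) * (K + K + 1))) * c)
      \<and> (\<lambda>v. adj p V f v - (y + of_nat p - 1) * f v) = h" if h: "l2b V h c" for h c
  proof -
    define k where "k u = m * (if u \<in> tails V then h (scons 0 u) else 0)
      + (\<Sum>i\<in>{1..p}. (if u \<in> tails V then h (scons i (e_inf i u)) else 0)
                      + (if u \<in> tails V then h (scons i u) else 0))" for u
    have "l2b (tails V) k (cmod m * c + (\<Sum>i\<in>{1..p}. c + c))"
      unfolding k_def[abs_def] using V'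
      by (intro l2b_add l2b_scale l2b_sum pull[OF h, where \<psi> = "\<lambda>u. u"] pull[OF h])
        (auto simp: invariant_def intro: inj_on_e_inf)
    then have "l2b (tails V) k ((cmod m + 2 * real p) * c)"
      by (simp add: algebra_simps)
    from C[OF this] obtain f where f: "l2b (tails V) f (C * ((cmod m + 2 * real p) * c))"
      and eq: "\<And>u. adj p (tails V) f u - (qmap p y + of_nat p - 1) * f u = k u"
      by (metis (no_types, lifting))
    have fK: "l2b (tails V) f (K * c)" using f by (simp add: K_def mult_ac)
    have "adj p V (schur_lift V m h f) v - (y + of_nat p - 1) * schur_lift V m h f v = h v" for v
      unfolding m_def using h f eq
      by (intro schur_lift_solves[OF V y]) (auto simp: l2b_def k_def m_def)
    moreover have "l2b V (schur_lift V m h f) ((K + real p * (cmod (1 / m) * (K + K + 1))) * c)"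
      using l2b_schur_lift[OF V h fK, of m] by (simp add: algebra_simps)
    ultimately show ?thesis by blast
  qed
  moreover have "f = (\<lambda>v. 0)" if f: "l2b V f c"
      and 0: "(\<lambda>v. adj p V f v - (y + of_nat p - 1) * f v) = (\<lambda>v. 0)" for f c
  proof -
    define f0 where "f0 = (\<lambda>u. if u \<in> tails V then f (scons 0 u) else 0)"
    have eq: "adj p V f v = (y + of_nat p - 1) * f v" for v using fun_cong[OF 0, of v] by simp
    have f_a: "m * f (scons a v) = f (scons 0 v) + f (scons 0 (e_inf_inv a v)) - 0"
      if "a \<in> {1..p}" "v \<in> tails V" for a v
      using eq[of "scons a v"] adj_scons[OF V that(2,1), of f] by (simp add: m_def algebra_simps)
    have "f0 = (\<lambda>v. 0)"
    proof (rule inj)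
      show "l2b (tails V) f0 c"
        unfolding f0_def using pull[OF f, of 0 "\<lambda>u. u"] by simp
      show "(\<lambda>u. adj p (tails V) f0 u - (qmap p y + of_nat p - 1) * f0 u) = (\<lambda>v. 0)"
      proof
        fix u
        show "adj p (tails V) f0 u - (qmap p y + of_nat p - 1) * f0 u = 0"
        proof (cases "u \<in> tails V")
          case True
          have "m * (adj p V f (scons 0 u) - (y + of_nat p - 1) * f (scons 0 u))
              = adj p (tails V) f0 u - (qmap p y + of_nat p - 1) * f0 u - (\<Sum>i\<in>{1..p}. 0 + 0)"
            unfolding m_def
            by (rule schur_equations[OF V True _ f0_def]) (use f_a m_def in auto)
          then show ?thesis using eq by simp
        qed (simp add: adj_def f0_def)
      qed
    qed
    then have z: "f (scons 0 u) = 0" if "u \<in> tails V" for u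
      using that unfolding f0_def fun_eq_iff by metis
    have "f v = 0" for v
    proof (cases "v \<in> V")
      case True
      obtain a u where v: "v = scons a u" and a: "a \<le> p" and u: "u \<in> tails V"
        using invariant_split[OF V True] .
      show ?thesis
      proof (cases "a = 0")
        case False
        then have a': "a \<in> {1..p}" using a by auto
        moreover have "e_inf_inv a u \<in> tails V" using u a' V' by (auto simp: invariant_def)
        ultimately show ?thesis using f_a[OF a' u] z u m v by simp
      qed (use z u v in simp)
    qed (use f in \<open>simp add: l2b_def\<close>)
    then show ?thesis by blast
  qed
  ultimately show ?thesis unfolding invertible_at_def by blast
qed

lemma invertible_at_iterate:
  assumes "invariant p V" "\<And>k. k < n \<Longrightarrow> (qmap p ^^ k) y \<noteq> of_nat p - 1"
    "cmod ((qmap p ^^ n) y + of_nat p - 1) > 2 * real p"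
  shows "invertible_at p V (y + of_nat p - 1)"
  using assms
proof (induction n arbitrary: V y)
  case 0
  then show ?case by (simp add: invertible_at_large)
next
  case (Suc n)
  show ?case
  proof (rule invertible_at_step[OF Suc.prems(1)])
    show "y \<noteq> of_nat p - 1" using Suc.prems(2)[of 0] by simp
    show "invertible_at p (tails V) (qmap p y + of_nat p - 1)"
    proof (rule Suc.IH[OF invariant_tails[OF Suc.prems(1)]])
      show "(qmap p ^^ k) (qmap p y) \<noteq> of_nat p - 1" if "k < n" for k
        using Suc.prems(2)[of "Suc k"] that by (simp add: funpow_swap1)
      show "cmod ((qmap p ^^ n) (qmap p y) + of_nat p - 1) > 2 * real p"
        using Suc.prems(3) by (simp add: funpow_swap1)
    qed
  qed
qed

section \<open>Eigenfunctions on the backward orbit\<close>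

definition eigenvalue_at :: "nat \<Rightarrow> (nat \<Rightarrow> nat) set \<Rightarrow> complex \<Rightarrow> bool" where
  "eigenvalue_at p V z \<longleftrightarrow> (\<exists>f\<in>l2 V. f \<noteq> (\<lambda>v. 0) \<and> adj p V f = (\<lambda>v. z * f v))"

text \<open>The eigenfunction is supported on two words starting with 1, with opposite signs, whose
  tails are interchanged by \<open>e_inf 1\<close>. The coupling \<open>1 + e_1\<close> to the
  letter 0 therefore cancels and only the diagonal \<open>2 (p - 1)\<close> acts.\<close>

lemma eigenvalue_at_center:
  assumes p: "p \<ge> 2" and V: "invariant p V" "V \<noteq> {}"
  shows "eigenvalue_at p V (of_nat p - 1 + of_nat p - 1)"
proof -
  note V1 = invariant_tails[OF V(1)] tails_nonempty[OF V]
  note V2 = invariant_tails[OF V1(1)] tails_nonempty[OF V1]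
  obtain t where t: "t \<in> tails (tails (tails V))"
    using tails_nonempty[OF V2] by blast
  \<comment> \<open>The letter 2, available since \<open>p \<ge> 2\<close>, stops the recursion of
    \<open>e_inf 1\<close>, so the generator exchanges the two words.\<close>
  define u0 u1 where "u0 = scons 0 (scons 2 t)" and "u1 = scons 1 (scons 2 t)"
  have mem: "u0 \<in> tails V" "u1 \<in> tails V"
    using t p by (auto simp: u0_def u1_def scons_mem_iff[OF V1(1)] scons_mem_iff[OF V2(1)])
  have ne: "u0 \<noteq> u1" by (simp add: u0_def u1_def)
  have e: "e_inf 1 u0 = u1" "e_inf 1 u1 = u0" by (simp_all add: u0_def u1_def e_inf_scons)
  have e': "e_inf 1 u = u0 \<longleftrightarrow> u = u1" "e_inf 1 u = u1 \<longleftrightarrow> u = u0" for u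
    using e e_inf_inv_e_inf[of 1] by (metis one_neq_zero)+
  define f :: "(nat \<Rightarrow> nat) \<Rightarrow> complex"
    where "f v = (if v = scons 1 u0 then 1 else if v = scons 1 u1 then -1 else 0)" for v
  have memV: "scons 1 u0 \<in> V" "scons 1 u1 \<in> V" using mem p by (auto simp: scons_mem_iff[OF V(1)])
  have "f \<in> l2 V"
  proof -
    have "(\<lambda>v. (cmod (f v))\<^sup>2) summable_on V"
      by (rule summable_on_cong_neutral[THEN iffD1, OF _ _ _ summable_on_finite[of "{scons 1 u0, scons 1 u1}"]])
        (use memV in \<open>auto simp: f_def simp del: One_nat_def\<close>)
    then show ?thesis using memV by (auto simp: l2_def f_def)
  qed
  moreover have "f (scons 1 u0) \<noteq> 0" by (simp add: f_def)
  moreover have "adj p V f v = (of_nat p - 1 + of_nat p - 1) * f v" for v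
  proof (cases "v \<in> V")
    case True
    define a u where "a = v 0" and "u = stl v"
    have v: "v = scons a u" by (simp add: a_def u_def)
    then have u: "u \<in> tails V" and a: "a \<le> p" using True scons_mem_iff[OF V(1)] by auto
    show ?thesis
    proof (cases "a = 0")
      case True
      have "f (scons i (e_inf i u)) + f (scons i u) = 0" for i
        using ne e' by (auto simp: f_def)
      then have "adj p V f (scons 0 u) = 0"
        by (simp add: adj_scons_0[OF V(1) u] del: sum.distrib)
      then show ?thesis using True by (simp add: v f_def)
    next
      case False
      then have "a \<in> {1..p}" using a by auto
      from adj_scons[OF V(1) u this, of f] show ?thesis by (simp add: v f_def)
    qed
  next
    case False
    then show ?thesis using memV by (auto simp: adj_def f_def)
  qed
  ultimately show ?thesis unfolding eigenvalue_at_def by (metis (no_types, lifting) ext)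
qed

text \<open>Back substitution with zero right-hand side; the lift is nonzero because it reproduces
  \<open>f\<close> on the letter 0.\<close>

lemma eigenvalue_at_step:
  assumes V: "invariant p V" and y: "y \<noteq> of_nat p - 1"
    and ev: "eigenvalue_at p (tails V) (qmap p y + of_nat p - 1)"
  shows "eigenvalue_at p V (y + of_nat p - 1)"
proof -
  define m where "m = y - (of_nat p - 1)"
  obtain f where f: "f \<in> l2 (tails V)" "f \<noteq> (\<lambda>v. 0)"
    and ev: "adj p (tails V) f = (\<lambda>v. (qmap p y + of_nat p - 1) * f v)"
    using ev by (auto simp: eigenvalue_at_def)
  let ?g = "schur_lift V m (\<lambda>v. 0) f"
  have f0: "f u = 0" if "u \<notin> tails V" for u using f that by (simp add: l2_def)
  have "adj p V ?g v - (y + of_nat p - 1) * ?g v = 0" for v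
    unfolding m_def by (rule schur_lift_solves[OF V y]) (use f0 ev in auto)
  then have "adj p V ?g = (\<lambda>v. (y + of_nat p - 1) * ?g v)" by auto
  moreover have "?g \<in> l2 V"
    using l2b_schur_lift[OF V l2b_zero l2b_l2norm[OF f(1)], of m] unfolding l2b_iff by blast
  moreover have "?g \<noteq> (\<lambda>v. 0)"
  proof -
    obtain u where u: "f u \<noteq> 0" using f(2) by auto
    then have "scons 0 u \<in> V" using f0 by (auto simp: tails_def)
    then have "?g (scons 0 u) \<noteq> 0" using u by (simp add: schur_lift_def)
    then show ?thesis by metis
  qed
  ultimately show ?thesis unfolding eigenvalue_at_def by blast
qed

lemma eigenvalue_at_preim:
  assumes p: "p \<ge> 2" and "invariant p V" "V \<noteq> {}" "y \<in> preim p (real p - 1) n"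
  shows "eigenvalue_at p V (of_real y + of_nat p - 1)"
  using assms(2-)
proof (induction n arbitrary: V y)
  case 0
  then show ?case using eigenvalue_at_center[OF p] by simp
next
  case (Suc n)
  have "y \<noteq> real p - 1"
    using preim_center_disjoint[OF p Suc.prems(3), of 0] by auto
  then have ne: "complex_of_real y \<noteq> of_nat p - 1"
    by (metis of_real_1 of_real_diff of_real_eq_iff of_real_of_nat_eq)
  have "qmap p y \<in> preim p (real p - 1) n" using Suc.prems(3) by (simp add: preim_Suc)
  from Suc.IH[OF invariant_tails[OF Suc.prems(1)] tails_nonempty[OF Suc.prems(1,2)] this]
  have "eigenvalue_at p (tails V) (qmap p (of_real y) + of_nat p - 1)"
    by (simp add: qmap_of_real)
  from eigenvalue_at_step[OF Suc.prems(1) ne this] show ?case .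
qed

text \<open>An eigenfunction for \<open>z'\<close> is multiplied by \<open>z' - z\<close> under
  \<open>A - z\<close>, so an inverse at \<open>z\<close> would have norm at least
  \<open>1 / dist z' z\<close>, which is unbounded.\<close>

lemma in_spec_if_approx_eigenvalues:
  assumes approx: "\<And>e. e > 0 \<Longrightarrow> \<exists>z'. eigenvalue_at p V z' \<and> dist z' z < e"
  shows "z \<in> spec p V"
proof (rule ccontr)
  assume "z \<notin> spec p V"
  then obtain B C where B: "\<And>f. f \<in> l2 V \<Longrightarrow> B (\<lambda>v. adj p V f v - z * f v) = f"
    and C: "\<And>f. f \<in> l2 V \<Longrightarrow> l2norm V (B f) \<le> C * l2norm V f"
    unfolding spec_def by blast
  \<comment> \<open>The bound \<open>C\<close> supplied by the definition of \<open>spec\<close> may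
    be nonpositive; a positive one is needed as a denominator.\<close>
  define C' where "C' = max C 0 + 1"
  have "C' > 0" by (simp add: C'_def)
  then obtain z' where ev: "eigenvalue_at p V z'" and d: "dist z' z < 1 / C'"
    using approx[of "1 / C'"] by auto
  obtain f where f: "f \<in> l2 V" "f \<noteq> (\<lambda>v. 0)" and Af: "adj p V f = (\<lambda>v. z' * f v)"
    using ev by (auto simp: eigenvalue_at_def)
  define h where "h v = (z' - z) * f v" for v
  have lh: "l2b V h (cmod (z' - z) * l2norm V f)"
    unfolding h_def[abs_def] by (rule l2b_scale[OF l2b_l2norm[OF f(1)]])
  have pos: "l2norm V f > 0"
  proof (rule ccontr)
    assume "\<not> l2norm V f > 0"
    then have "l2b V f 0" using f(1) by (simp add: l2b_iff)
    then show False using f(2) by (simp add: l2b_0_iff)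
  qed
  have "(\<lambda>v. adj p V f v - z * f v) = h" by (auto simp: Af h_def algebra_simps)
  then have "B h = f" using B[OF f(1)] by simp
  then have "l2norm V f \<le> C * l2norm V h" using C[of h] lh by (simp add: l2b_iff)
  also have "\<dots> \<le> C' * l2norm V h"
    using l2b_nonneg[OF l2b_l2norm[of h V]] lh by (intro mult_right_mono) (auto simp: C'_def l2b_iff)
  also have "\<dots> \<le> C' * (cmod (z' - z) * l2norm V f)"
    using lh \<open>C' > 0\<close> by (intro mult_left_mono) (auto simp: l2b_iff)
  also have "\<dots> = (C' * dist z' z) * l2norm V f" by (simp add: dist_norm)
  also have "\<dots> < 1 * l2norm V f"
    using d pos \<open>C' > 0\<close> by (intro mult_strict_right_mono) (auto simp: field_simps)
  finally show False by simp
qed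

section \<open>The spectrum of a closed vertex set\<close>

text \<open>Along the backward orbit every radicand \<open>u + p (p + 1)\<close> is positive, so the
  complex square roots are the two real ones and no further complex preimages exist.\<close>

lemma real_if_funpow_qmap_real:
  fixes y :: complex
  assumes p: "p \<ge> 2" and t: "\<bar>t\<bar> \<le> real p + 1" and y: "(qmap p ^^ n) y = of_real t"
  shows "\<exists>x\<in>preim p t n. y = of_real x"
  using y
proof (induction n arbitrary: y)
  case 0
  then show ?case by simp
next
  case (Suc n)
  then obtain u where u: "u \<in> preim p t n" "qmap p y = of_real u"
    using Suc.IH[of "qmap p y"] Suc.prems by (auto simp: funpow_swap1)
  define s where "s = sqrt (u + real p * (real p + 1))"
  have "u > - (real p * (real p + 1))"
    using critical_value_lt[OF p] preim_abs_le[OF u(1) t] by blast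
  then have s2: "s\<^sup>2 = u + real p * (real p + 1)" by (simp add: s_def)
  have "y\<^sup>2 = of_real u + of_nat p * (of_nat p + 1)"
    using u(2) by (simp add: qmap_def algebra_simps)
  also have "\<dots> = of_real (s\<^sup>2)" by (simp add: s2)
  finally have "y\<^sup>2 = (of_real s)\<^sup>2" by simp
  then have "y = of_real s \<or> y = of_real (- s)" by (simp add: power2_eq_iff)
  then obtain x where x: "y = of_real x" by blast
  moreover have "qmap p x = u" using u(2) unfolding x qmap_of_real by simp
  ultimately show ?case using u(1) by (auto simp: preim_Suc)
qed

theorem spec_invariant:
  assumes p: "p \<ge> 2" and V: "invariant p V" "V \<noteq> {}"
  shows "spec p V = complex_of_real ` spec_set p"
proof
  show "complex_of_real ` spec_set p \<subseteq> spec p V"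
  proof
    fix z assume "z \<in> complex_of_real ` spec_set p"
    then obtain y where y: "y \<in> closure (preims p)" and z: "z = of_real (real p - 1 + y)"
      unfolding spec_set_eq[OF p] closure_preims[OF p] by blast
    show "z \<in> spec p V"
    proof (rule in_spec_if_approx_eigenvalues)
      fix e :: real assume "e > 0"
      then obtain x where x: "x \<in> preims p" "dist x y < e"
        using y by (auto simp: closure_approachable)
      then obtain n where "x \<in> preim p (real p - 1) n" by (auto simp: preims_def)
      from eigenvalue_at_preim[OF p V this]
      have "eigenvalue_at p V (of_real x + of_nat p - 1)" .
      moreover have "dist (of_real x + of_nat p - 1) z = dist x y"
      proof -
        have "of_real x + of_nat p - 1 - z = of_real (x - y)" by (simp add: z)
        then show ?thesis by (simp only: dist_norm norm_of_real real_norm_def)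
      qed
      ultimately show "\<exists>z'. eigenvalue_at p V z' \<and> dist z' z < e" using x by metis
    qed
  qed
  show "spec p V \<subseteq> complex_of_real ` spec_set p"
  proof
    fix z assume z: "z \<in> spec p V"
    define y where "y = z - (of_nat p - 1)"
    have zy: "z = y + of_nat p - 1" by (simp add: y_def)
    have in_set: "z \<in> complex_of_real ` spec_set p"
      if "y = of_real x" "x \<in> julia p \<union> preims p" for x
    proof -
      have "z = of_real (real p - 1 + x)" by (simp add: zy that(1))
      then show ?thesis using that(2) unfolding spec_set_eq[OF p] by blast
    qed
    show "z \<in> complex_of_real ` spec_set p"
    proof (rule ccontr)
      assume no: "z \<notin> complex_of_real ` spec_set p"
      have ne: "(qmap p ^^ k) y \<noteq> of_nat p - 1" for k
      proof
        assume "(qmap p ^^ k) y = of_nat p - 1"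
        then have "(qmap p ^^ k) y = of_real (real p - 1)" by simp
        then obtain x where "x \<in> preim p (real p - 1) k" "y = of_real x"
          using real_if_funpow_qmap_real[OF p abs_center_le[OF p]] by blast
        then show False using no in_set by (auto simp: preims_def)
      qed
      \<comment> \<open>A bounded orbit would force \<open>y\<close> to be real, hence in the Julia
        set, whose translate lies in the candidate spectrum.\<close>
      have "\<exists>n. cmod ((qmap p ^^ n) y) > real p + 1"
      proof (rule ccontr)
        assume "\<not> ?thesis"
        then have bd: "cmod ((qmap p ^^ n) y) \<le> real p + 1" for n by (simp add: not_less)
        then have yr: "y = of_real (Re y)"
          using Im_eq_0_if_funpow_qmap_bounded[OF p] by (simp add: complex_eq_iff)
        have "\<bar>(qmap p ^^ n) (Re y)\<bar> \<le> real p + 1" for n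
          using bd[of n] by (subst (asm) yr) (simp only: funpow_qmap_of_real norm_of_real)
        then have "Re y \<in> julia p" by (simp add: julia_def)
        then show False using no in_set[OF yr] by blast
      qed
      then obtain n where n: "cmod ((qmap p ^^ n) y) > real p + 1" by blast
      define w where "w = (qmap p ^^ n) y"
      have w: "cmod w - (real p + 1) > 0" using n by (simp add: w_def)
      \<comment> \<open>The iterate is pushed beyond norm \<open>3 p + 1\<close>, so that the shift
        by \<open>p - 1\<close>, which returns to the spectral parameter, still leaves more than
        \<open>2 p\<close>.\<close>
      obtain k where k: "2 ^ k > (2 * real p) / (cmod w - (real p + 1))"
        using real_arch_pow[of 2] by auto
      then have "2 ^ k * (cmod w - (real p + 1)) > 2 * real p"
        using w by (simp add: pos_divide_less_eq)
      then have "cmod ((qmap p ^^ k) w) - (real p + 1) > 2 * real p"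
        using funpow_qmap_escape[of p w k] w by linarith
      moreover have "cmod ((qmap p ^^ k) w + (of_nat p - 1))
          \<ge> cmod ((qmap p ^^ k) w) - cmod (of_nat p - 1)"
        by (rule norm_diff_ineq)
      moreover have "cmod (of_nat p - 1) = real p - 1"
      proof -
        have "complex_of_nat p - 1 = of_real (real p - 1)" by simp
        then have "cmod (of_nat p - 1) = \<bar>real p - 1\<bar>" by (simp only: norm_of_real)
        also have "\<dots> = real p - 1" using p by simp
        finally show ?thesis .
      qed
      ultimately have "cmod ((qmap p ^^ (k + n)) y + of_nat p - 1) > 2 * real p"
        by (simp add: funpow_add w_def add_diff_eq)
      then have "invertible_at p V z"
        unfolding zy using ne by (intro invertible_at_iterate[OF V(1), of "k + n"]) auto
      then show False using not_in_spec_if_invertible_at[OF V(1)] z by blast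
    qed
  qed
qed

section \<open>Characteristic polynomials of the finite graphs\<close>

text \<open>The first letter is the least significant digit: the word with first letter
  \<open>a\<close> and tail of index \<open>r\<close> has index
  \<open>a + (p + 1) * r\<close>.\<close>

lemma word_of_Suc: "word_of p (Suc n) k = (k mod (p + 1)) # word_of p n (k div (p + 1))"
proof -
  have "[0..<Suc n] = 0 # map Suc [0..<n]" by (simp add: map_Suc_upt upt_conv_Cons del: upt_Suc)
  then show ?thesis
    unfolding word_of_def by (simp only: list.map map_map comp_def power_Suc power_0 div_by_1 div_mult2_eq)
qed

lemma inj_on_word_of: "inj_on (word_of p n) {..<(p + 1) ^ n}"
proof (induction n)
  case (Suc n)
  show ?case
  proof (rule inj_onI)
    fix k l assume k: "k \<in> {..<(p + 1) ^ Suc n}" and l: "l \<in> {..<(p + 1) ^ Suc n}"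
      and eq: "word_of p (Suc n) k = word_of p (Suc n) l"
    have "k div (p + 1) < (p + 1) ^ n" "l div (p + 1) < (p + 1) ^ n"
      using k l by (auto simp: less_mult_imp_div_less mult.commute)
    then have "k div (p + 1) = l div (p + 1)"
      using eq Suc unfolding word_of_Suc by (auto dest: inj_onD)
    moreover have "k mod (p + 1) = l mod (p + 1)" using eq unfolding word_of_Suc by simp
    ultimately show "k = l" by (metis div_mult_mod_eq)
  qed
qed (simp add: inj_on_def)

lemma word_of_image: "word_of p n ` {..<(p + 1) ^ n} = {w. set w \<subseteq> {..p} \<and> length w = n}"
proof (rule card_subset_eq)
  show "finite {w. set w \<subseteq> {..p} \<and> length w = n}" by (simp add: finite_lists_length_eq)
  show "word_of p n ` {..<(p + 1) ^ n} \<subseteq> {w. set w \<subseteq> {..p} \<and> length w = n}"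
    by (auto simp: word_of_def less_Suc_eq_le[symmetric])
  show "card (word_of p n ` {..<(p + 1) ^ n}) = card {w. set w \<subseteq> {..p} \<and> length w = n}"
    unfolding card_image[OF inj_on_word_of] by (simp add: card_lists_length_eq)
qed

lemma inj_e_fin: "i \<noteq> 0 \<Longrightarrow> e_fin i v = e_fin i w \<Longrightarrow> v = w"
proof (induction v arbitrary: w)
  case Nil
  then show ?case by (cases w) (auto split: if_splits)
next
  case (Cons a v)
  then show ?case by (cases w) (auto split: if_splits)
qed

lemma length_e_fin [simp]: "length (e_fin i w) = length w"
  by (induction w) auto

lemma set_e_fin: "i \<le> p \<Longrightarrow> set w \<subseteq> {..p} \<Longrightarrow> set (e_fin i w) \<subseteq> {..p}"
  by (induction w) auto

definition efin_entry :: "nat \<Rightarrow> nat \<Rightarrow> nat \<Rightarrow> nat \<Rightarrow> nat \<Rightarrow> real" where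
  "efin_entry p n i r c = (if e_fin i (word_of p n r) = word_of p n c then 1 else 0)"

lemma word_of_eq_iff:
  "r < (p + 1) ^ n \<Longrightarrow> c < (p + 1) ^ n \<Longrightarrow> word_of p n r = word_of p n c \<longleftrightarrow> r = c"
  using inj_on_word_of[of p n] by (auto simp: inj_on_def)

text \<open>The matrix form of unitarity, \<open>M_i * M_i\<^sup>T = 1\<close>: distinct words have
  distinct images under an injective map.\<close>

lemma efin_entry_orthogonal:
  assumes i: "i \<in> {1..p}" and r: "r < (p + 1) ^ n" and c: "c < (p + 1) ^ n"
  shows "(\<Sum>s<(p + 1) ^ n. efin_entry p n i r s * efin_entry p n i c s) = (if r = c then 1 else 0)"
proof -
  have "word_of p n r \<in> word_of p n ` {..<(p + 1) ^ n}" using r by blast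
  then have "e_fin i (word_of p n r) \<in> word_of p n ` {..<(p + 1) ^ n}"
    unfolding word_of_image using i set_e_fin by auto
  then obtain t where t: "t < (p + 1) ^ n" "e_fin i (word_of p n r) = word_of p n t" by auto
  have "(\<Sum>s<(p + 1) ^ n. efin_entry p n i r s * efin_entry p n i c s)
      = (\<Sum>s<(p + 1) ^ n. if s = t then efin_entry p n i c t else 0)"
    using t by (intro sum.cong refl) (auto simp: efin_entry_def word_of_eq_iff)
  also have "\<dots> = efin_entry p n i c t" using t by simp
  also have "\<dots> = (if r = c then 1 else 0)"
    unfolding efin_entry_def t(2)[symmetric] using i inj_e_fin[of i] word_of_eq_iff[OF r c] by auto
  finally show ?thesis .
qed

lemma adj_fin_entry:
  assumes "r < (p + 1) ^ n" "c < (p + 1) ^ n"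
  shows "adj_fin p n $$ (r, c) = (\<Sum>i\<in>{1..p}. efin_entry p n i r c + efin_entry p n i c r)"
  using assms by (simp add: adj_fin_def efin_entry_def)

lemma adj_fin_carrier [simp]: "adj_fin p n \<in> carrier_mat ((p + 1) ^ n) ((p + 1) ^ n)"
  by (simp add: adj_fin_def)

lemma efin_entry_Suc:
  assumes "r < (p + 1) ^ n" "c < (p + 1) ^ n" "a \<le> p" "b \<le> p" "i \<noteq> 0"
  shows "efin_entry p (Suc n) i (a + (p + 1) * r) (b + (p + 1) * c)
    = (if a = 0 then (if b = i then efin_entry p n i r c else 0)
       else if a = i then (if b = 0 \<and> r = c then 1 else 0)
       else if b = a \<and> r = c then 1 else 0)"
proof -
  have "word_of p (Suc n) (a + (p + 1) * r) = a # word_of p n r" if "a \<le> p" for a r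
    using that unfolding word_of_Suc by (simp del: mult_Suc)
  then show ?thesis using assms by (auto simp: efin_entry_def word_of_eq_iff)
qed

text \<open>The entries of \<open>1 + M_i\<close>, the coupling between the letters 0 and
  \<open>i\<close>.\<close>

definition star_entry :: "nat \<Rightarrow> nat \<Rightarrow> nat \<Rightarrow> nat \<Rightarrow> nat \<Rightarrow> real" where
  "star_entry p n i r c = efin_entry p n i r c + (if r = c then 1 else 0)"

lemma adj_fin_Suc_entry:
  assumes "r < (p + 1) ^ n" "c < (p + 1) ^ n" "a \<le> p" "b \<le> p"
  shows "adj_fin p (Suc n) $$ (a + (p + 1) * r, b + (p + 1) * c) =
    (if a = 0 then (if b = 0 then 0 else star_entry p n b r c)
     else if b = 0 then star_entry p n a c r
     else if a = b \<and> r = c then 2 * (real p - 1) else 0)"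
proof -
  have lt: "a + (p + 1) * r < (p + 1) ^ Suc n" if "r < (p + 1) ^ n" "a \<le> p" for a r
  proof -
    have "a + (p + 1) * r < (p + 1) * Suc r" using that(2) by simp
    also have "\<dots> \<le> (p + 1) * (p + 1) ^ n" using that(1) by (intro mult_le_mono) auto
    finally show ?thesis by simp
  qed
  let ?E = "\<lambda>i. efin_entry p (Suc n) i (a + (p + 1) * r) (b + (p + 1) * c)
        + efin_entry p (Suc n) i (b + (p + 1) * c) (a + (p + 1) * r)"
  have E: "adj_fin p (Suc n) $$ (a + (p + 1) * r, b + (p + 1) * c) = (\<Sum>i\<in>{1..p}. ?E i)"
    using assms lt by (intro adj_fin_entry) auto
  have ent: "?E i = (if a = 0 then (if b = i then efin_entry p n i r c else 0)
       else if a = i then (if b = 0 \<and> r = c then 1 else 0)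
       else if b = a \<and> r = c then 1 else 0) + (if b = 0 then (if a = i then efin_entry p n i c r else 0)
       else if b = i then (if a = 0 \<and> c = r then 1 else 0)
       else if a = b \<and> c = r then 1 else 0)" if "i \<in> {1..p}" for i
  proof -
    have i: "i \<noteq> 0" using that by simp
    show ?thesis
      unfolding efin_entry_Suc[OF assms i] efin_entry_Suc[OF assms(2,1,4,3) i] by (rule refl)
  qed
  consider "a = 0" "b = 0" | "a = 0" "b \<noteq> 0" | "a \<noteq> 0" "b = 0" | "a \<noteq> 0" "b \<noteq> 0" by blast
  then show ?thesis
  proof cases
    case 1
    have "(\<Sum>i\<in>{1..p}. ?E i) = (\<Sum>i\<in>{1..p}. 0)"
      by (intro sum.cong refl) (simp only: ent, simp add: 1)
    then show ?thesis unfolding E using 1 by simp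
  next
    case 2
    have "(\<Sum>i\<in>{1..p}. ?E i) = (\<Sum>i\<in>{1..p}. if i = b then star_entry p n i r c else 0)"
      by (intro sum.cong refl) (simp only: ent, auto simp: 2 star_entry_def)
    then show ?thesis unfolding E using 2 assms by simp
  next
    case 3
    have "(\<Sum>i\<in>{1..p}. ?E i) = (\<Sum>i\<in>{1..p}. if i = a then star_entry p n i c r else 0)"
      by (intro sum.cong refl) (simp only: ent, auto simp: 3 star_entry_def)
    then show ?thesis unfolding E using 3 assms by simp
  next
    case 4
    \<comment> \<open>Every generator gives a loop at this vertex except the one belonging to its
      first letter; that one is subtracted from the full count.\<close>
    have "(\<Sum>i\<in>{1..p}. ?E i) = (\<Sum>i\<in>{1..p}. (if a = b \<and> r = c then 2 else 0)
        - (if i = a then (if a = b \<and> r = c then 2 else 0) else 0))"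
      by (intro sum.cong refl) (simp only: ent, auto simp: 4)
    also have "\<dots> = (if a = b \<and> r = c then 2 * (real p - 1) else 0)"
      using 4 assms by (simp add: sum_subtractf)
    finally show ?thesis unfolding E using 4 by simp
  qed
qed

section \<open>Block determinants\<close>

lemma sum_div_mod:
  fixes g :: "nat \<Rightarrow> nat \<Rightarrow> real"
  assumes "N > 0"
  shows "(\<Sum>j<m * N. g (j div N) (j mod N)) = (\<Sum>a<m. \<Sum>s<N. g a s)"
proof -
  have lt: "a * N + s < m * N" if "a < m" "s < N" for a s
  proof -
    have "a * N + s < Suc a * N" using that(2) by simp
    also have "\<dots> \<le> m * N" using that(1) by (intro mult_le_mono) auto
    finally show ?thesis .
  qed
  have "(\<Sum>j<m * N. g (j div N) (j mod N)) = (\<Sum>(a, s)\<in>{..<m} \<times> {..<N}. g a s)"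
    by (rule sum.reindex_bij_witness[where j = "\<lambda>j. (j div N, j mod N)" and i = "\<lambda>(a, s). a * N + s"])
      (use assms lt in \<open>auto simp: less_mult_imp_div_less\<close>)
  then show ?thesis by (simp add: sum.cartesian_product)
qed

text \<open>The Schur complement as a product: the right factor \<open>?Y\<close> is block
  triangular with determinant \<open>m ^ N\<close> and clears the lower left block.\<close>

lemma det_star_block:
  fixes B :: "real mat"
  assumes B: "B \<in> carrier_mat N M" and m: "m \<noteq> 0"
  shows "det (four_block_mat (x \<cdot>\<^sub>m 1\<^sub>m N) B (transpose_mat B) (m \<cdot>\<^sub>m 1\<^sub>m M)) * m ^ N
    = det ((x * m) \<cdot>\<^sub>m 1\<^sub>m N - B * transpose_mat B) * m ^ M"
proof -
  let ?X = "four_block_mat (x \<cdot>\<^sub>m 1\<^sub>m N) B (transpose_mat B) (m \<cdot>\<^sub>m 1\<^sub>m M)"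
  let ?Y = "four_block_mat (m \<cdot>\<^sub>m 1\<^sub>m N) (0\<^sub>m N M) (- transpose_mat B) (1\<^sub>m M)"
  have Bt: "transpose_mat B \<in> carrier_mat M N" using B by simp
  have "?X * ?Y = four_block_mat
      ((x \<cdot>\<^sub>m 1\<^sub>m N) * (m \<cdot>\<^sub>m 1\<^sub>m N) + B * (- transpose_mat B))
      ((x \<cdot>\<^sub>m 1\<^sub>m N) * 0\<^sub>m N M + B * 1\<^sub>m M)
      (transpose_mat B * (m \<cdot>\<^sub>m 1\<^sub>m N) + (m \<cdot>\<^sub>m 1\<^sub>m M) * (- transpose_mat B))
      (transpose_mat B * 0\<^sub>m N M + (m \<cdot>\<^sub>m 1\<^sub>m M) * 1\<^sub>m M)"
    using B Bt by (intro mult_four_block_mat) auto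
  also have "(x \<cdot>\<^sub>m 1\<^sub>m N) * (m \<cdot>\<^sub>m 1\<^sub>m N) + B * (- transpose_mat B)
      = (x * m) \<cdot>\<^sub>m 1\<^sub>m N - B * transpose_mat B"
    using B Bt by (intro eq_matI) (auto simp: mult_smult_assoc_mat[of _ N N _ N] mult_smult_distrib[of _ N N _ N])
  also have "(x \<cdot>\<^sub>m 1\<^sub>m N) * 0\<^sub>m N M + B * 1\<^sub>m M = B" using B by auto
  also have "transpose_mat B * (m \<cdot>\<^sub>m 1\<^sub>m N) + (m \<cdot>\<^sub>m 1\<^sub>m M) * (- transpose_mat B) = 0\<^sub>m M N"
    using B Bt by (intro eq_matI) (auto simp: mult_smult_assoc_mat[of _ M M _ N] mult_smult_distrib[of _ M N _ N])
  also have "transpose_mat B * 0\<^sub>m N M + (m \<cdot>\<^sub>m 1\<^sub>m M) * 1\<^sub>m M = m \<cdot>\<^sub>m 1\<^sub>m M" using B by auto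
  finally have XY: "?X * ?Y = four_block_mat ((x * m) \<cdot>\<^sub>m 1\<^sub>m N - B * transpose_mat B) B (0\<^sub>m M N) (m \<cdot>\<^sub>m 1\<^sub>m M)" .
  have "det ?X * det ?Y = det (?X * ?Y)"
    using B by (intro det_mult[symmetric]) auto
  also have "\<dots> = det ((x * m) \<cdot>\<^sub>m 1\<^sub>m N - B * transpose_mat B) * det (m \<cdot>\<^sub>m 1\<^sub>m M)"
    unfolding XY using B by (intro det_four_block_mat_lower_left_zero) auto
  also have "det ?Y = det (m \<cdot>\<^sub>m 1\<^sub>m N) * det (1\<^sub>m M :: real mat)"
    using B by (intro det_four_block_mat_upper_right_zero) auto
  finally show ?thesis by simp
qed

text \<open>The sign of the permutation enters once for the rows and, after a transposition, once
  for the columns, and cancels.\<close>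

lemma det_permute_rows_cols:
  fixes A :: "real mat"
  assumes A: "A \<in> carrier_mat n n" and \<pi>: "\<pi> permutes {0..<n}"
  shows "det (mat n n (\<lambda>(i, j). A $$ (\<pi> i, \<pi> j))) = det A"
proof -
  have lt: "\<pi> i < n" if "i < n" for i using permutes_in_image[OF \<pi>] that by auto
  let ?A1 = "mat n n (\<lambda>(i, j). A $$ (\<pi> i, j))"
  have "mat n n (\<lambda>(i, j). A $$ (\<pi> i, \<pi> j))
      = transpose_mat (mat n n (\<lambda>(i, j). transpose_mat ?A1 $$ (\<pi> i, j)))"
    using lt by (intro eq_matI) auto
  then have "det (mat n n (\<lambda>(i, j). A $$ (\<pi> i, \<pi> j)))
      = det (mat n n (\<lambda>(i, j). transpose_mat ?A1 $$ (\<pi> i, j)))"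
    by (simp add: det_transpose[of _ n])
  also have "\<dots> = signof \<pi> * det (transpose_mat ?A1)"
    by (intro det_permute_rows \<pi>) simp
  also have "\<dots> = signof \<pi> * (signof \<pi> * det A)"
    using det_permute_rows[OF A \<pi>] by (simp add: det_transpose[of _ n])
  also have "\<dots> = det A" by (cases "evenperm \<pi>") (simp_all add: sign_def)
  finally show ?thesis .
qed

lemma poly_char_poly:
  fixes A :: "real mat"
  assumes "A \<in> carrier_mat n n"
  shows "poly (char_poly A) x = det (x \<cdot>\<^sub>m 1\<^sub>m n - A)"
  unfolding char_poly_def using assms
  by (intro poly_det_cong[of _ n]) (auto simp: char_poly_matrix_def)

text \<open>With vertices sorted by first letter the matrix is a star of blocks whose
  \<open>p * N\<close> outer diagonal entries are all \<open>m\<close>. The Schur identity leaves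
  \<open>m ^ (p * N - N)\<close>, and \<open>B * B\<^sup>T\<close> is again \<open>2 p\<close> plus
  the adjacency matrix one level down.\<close>

lemma poly_char_poly_adj_fin_Suc:
  assumes p: "p \<ge> 1" and x: "x \<noteq> 2 * (real p - 1)"
  shows "poly (char_poly (adj_fin p (Suc n))) x
    = (x - 2 * (real p - 1)) ^ ((p - 1) * (p + 1) ^ n)
      * poly (char_poly (adj_fin p n)) (x * (x - 2 * (real p - 1)) - 2 * real p)"
proof -
  define N where "N = (p + 1) ^ n"
  define m where "m = x - 2 * (real p - 1)"
  have m: "m \<noteq> 0" using x by (simp add: m_def)
  have N: "N > 0" by (simp add: N_def)
  have size: "(p + 1) ^ Suc n = N + p * N" by (simp add: N_def)
  \<comment> \<open>Converts block order, where the first letter is the quotient by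
    \<open>N\<close>, into the order of \<open>word_of\<close>, where it is the remainder modulo
    \<open>p + 1\<close>.\<close>
  define \<pi> where "\<pi> i = (if i < N + p * N then i div N + (p + 1) * (i mod N) else i)" for i
  have divle: "i div N \<le> p" if "i < N + p * N" for i
  proof -
    have "i < (p + 1) * N" using that by simp
    then have "i div N < p + 1" by (rule less_mult_imp_div_less)
    then show ?thesis by simp
  qed
  have \<pi>: "\<pi> permutes {0..<N + p * N}"
  proof (rule bij_imp_permutes)
    have inj: "inj_on \<pi> {0..<N + p * N}"
    proof (rule inj_onI)
      fix i j assume i: "i \<in> {0..<N + p * N}" and j: "j \<in> {0..<N + p * N}" and "\<pi> i = \<pi> j"
      then have eq: "i div N + (p + 1) * (i mod N) = j div N + (p + 1) * (j mod N)"
        by (simp add: \<pi>_def)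
      have "i div N < p + 1" "j div N < p + 1" using i j divle by (auto simp: less_Suc_eq_le)
      then have "i div N = j div N" "i mod N = j mod N"
        using arg_cong[OF eq, of "\<lambda>k. k mod (p + 1)"] arg_cong[OF eq, of "\<lambda>k. k div (p + 1)"]
        by (simp_all del: mult_Suc)
      then show "i = j" by (metis div_mult_mod_eq)
    qed
    have "\<pi> ` {0..<N + p * N} \<subseteq> {0..<N + p * N}"
    proof
      fix k assume "k \<in> \<pi> ` {0..<N + p * N}"
      then obtain i where i: "i < N + p * N" "k = i div N + (p + 1) * (i mod N)"
        by (auto simp: \<pi>_def)
      have "k < (p + 1) * Suc (i mod N)" using divle[OF i(1)] i(2) by simp
      also have "\<dots> \<le> (p + 1) * N" using N by (intro mult_le_mono) (auto simp: Suc_le_eq)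
      finally show "k \<in> {0..<N + p * N}" by simp
    qed
    then have "\<pi> ` {0..<N + p * N} = {0..<N + p * N}"
      using inj by (intro card_subset_eq) (auto simp: card_image)
    then show "bij_betw \<pi> {0..<N + p * N} {0..<N + p * N}" using inj by (simp add: bij_betw_def)
  qed (simp add: \<pi>_def)
  \<comment> \<open>The minus sign comes from \<open>x - A\<close> and disappears in
    \<open>B * transpose_mat B\<close>; the \<open>Suc\<close> appears because the outer blocks are
    numbered from 0 but belong to the letters from 1.\<close>
  define B where "B = mat N (p * N) (\<lambda>(r, j). - star_entry p n (Suc (j div N)) r (j mod N))"
  have B: "B \<in> carrier_mat N (p * N)" by (simp add: B_def)
  let ?X = "x \<cdot>\<^sub>m 1\<^sub>m (N + p * N) - adj_fin p (Suc n)"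
  have carr: "adj_fin p (Suc n) \<in> carrier_mat (N + p * N) (N + p * N)"
    using adj_fin_carrier[of p "Suc n"] unfolding size .
  have modN: "i mod N < (p + 1) ^ n" for i using N by (simp add: N_def)
  have perm: "mat (N + p * N) (N + p * N) (\<lambda>(i, j). ?X $$ (\<pi> i, \<pi> j))
      = four_block_mat (x \<cdot>\<^sub>m 1\<^sub>m N) B (transpose_mat B) (m \<cdot>\<^sub>m 1\<^sub>m (p * N))" (is "?L = ?R")
  proof (rule eq_matI)
    fix i j assume "i < dim_row ?R" "j < dim_col ?R"
    then have i: "i < N + p * N" and j: "j < N + p * N" using B by auto
    have \<pi>lt: "\<pi> i < N + p * N" "\<pi> j < N + p * N"
      using permutes_in_image[OF \<pi>] i j by auto
    have \<pi>eq: "\<pi> i = \<pi> j \<longleftrightarrow> i = j" using permutes_inj[OF \<pi>] by (auto simp: inj_def)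
    have split: "i = j \<longleftrightarrow> i div N = j div N \<and> i mod N = j mod N" by (metis div_mult_mod_eq)
    have "?L $$ (i, j) = (if i = j then x else 0) - adj_fin p (Suc n) $$ (\<pi> i, \<pi> j)"
      using i j \<pi>lt \<pi>eq carr by auto
    also have "adj_fin p (Suc n) $$ (\<pi> i, \<pi> j) =
      (if i div N = 0 then (if j div N = 0 then 0 else star_entry p n (j div N) (i mod N) (j mod N))
       else if j div N = 0 then star_entry p n (i div N) (j mod N) (i mod N)
       else if i div N = j div N \<and> i mod N = j mod N then 2 * (real p - 1) else 0)"
      unfolding \<pi>_def using i j
      by (simp only: if_True adj_fin_Suc_entry[OF modN modN divle[OF i] divle[OF j]])
    finally have L: "?L $$ (i, j) = (if i = j then x else 0) - \<dots>" .
    have ge: "k div N = Suc ((k - N) div N)" "(k - N) mod N = k mod N" if "\<not> k < N" for k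
      using that N by (auto simp: le_div_geq le_mod_geq not_less)
    have lt: "k div N = 0" "k mod N = k" if "k < N" for k using that by auto
    consider "i < N" "j < N" | "i < N" "\<not> j < N" | "\<not> i < N" "j < N" | "\<not> i < N" "\<not> j < N" by blast
    then show "?L $$ (i, j) = ?R $$ (i, j)"
    proof cases
      case 1
      then show ?thesis unfolding L using i j B by (simp add: lt)
    next
      case 2
      then show ?thesis unfolding L using i j B by (auto simp: lt ge B_def)
    next
      case 3
      then show ?thesis unfolding L using i j B by (auto simp: lt ge B_def)
    next
      case 4
      then have "i - N = j - N \<longleftrightarrow> i = j" by auto
      then show ?thesis unfolding L using i j B 4 ge[OF 4(1)] ge[OF 4(2)]
        by (auto simp: m_def split)
    qed
  qed (use B in auto)
  have "det ?X = det (mat (N + p * N) (N + p * N) (\<lambda>(i, j). ?X $$ (\<pi> i, \<pi> j)))"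
    using carr by (intro det_permute_rows_cols[OF _ \<pi>, symmetric]) auto
  then have "det ?X * m ^ N = det ((x * m) \<cdot>\<^sub>m 1\<^sub>m N - B * transpose_mat B) * m ^ (p * N)"
    unfolding perm by (simp add: det_star_block[OF B m])
  moreover have "m ^ (p * N) = m ^ ((p - 1) * N) * m ^ N"
  proof -
    have "p * N = (p - 1) * N + N" using p by (simp add: algebra_simps flip: mult_Suc)
    then show ?thesis by (simp only: power_add)
  qed
  ultimately have "det ?X * m ^ N
      = (m ^ ((p - 1) * N) * det ((x * m) \<cdot>\<^sub>m 1\<^sub>m N - B * transpose_mat B)) * m ^ N"
    by (simp only: mult_ac)
  then have det: "det ?X = m ^ ((p - 1) * N) * det ((x * m) \<cdot>\<^sub>m 1\<^sub>m N - B * transpose_mat B)"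
    using m by simp
  have "(x * m) \<cdot>\<^sub>m 1\<^sub>m N - B * transpose_mat B = (x * m - 2 * real p) \<cdot>\<^sub>m 1\<^sub>m N - adj_fin p n"
  proof (rule eq_matI)
    have carr': "adj_fin p n \<in> carrier_mat N N" using adj_fin_carrier[of p n] unfolding N_def .
    fix r c assume "r < dim_row ((x * m - 2 * real p) \<cdot>\<^sub>m 1\<^sub>m N - adj_fin p n)"
      "c < dim_col ((x * m - 2 * real p) \<cdot>\<^sub>m 1\<^sub>m N - adj_fin p n)"
    then have r: "r < N" and c: "c < N" using carr' by auto
    have "(B * transpose_mat B) $$ (r, c) = (\<Sum>j<p * N. star_entry p n (Suc (j div N)) r (j mod N)
        * star_entry p n (Suc (j div N)) c (j mod N))"
      using r c B by (auto simp: scalar_prod_def B_def atLeast0LessThan intro!: sum.cong)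
    also have "\<dots> = (\<Sum>a<p. \<Sum>s<N. star_entry p n (Suc a) r s * star_entry p n (Suc a) c s)"
      by (rule sum_div_mod[OF N])
    also have "\<dots> = (\<Sum>a<p. (if r = c then 2 else 0) + (efin_entry p n (Suc a) r c + efin_entry p n (Suc a) c r))"
    proof (rule sum.cong[OF refl])
      fix a assume a: "a \<in> {..<p}"
      \<comment> \<open>Expansion of \<open>(1 + M) (1 + M)\<^sup>T\<close> into
        \<open>M M\<^sup>T\<close>, \<open>M\<close>, \<open>M\<^sup>T\<close> and 1.\<close>
      have "(\<Sum>s<N. star_entry p n (Suc a) r s * star_entry p n (Suc a) c s)
        = (\<Sum>s<N. efin_entry p n (Suc a) r s * efin_entry p n (Suc a) c s)
          + (\<Sum>s<N. if s = c then efin_entry p n (Suc a) r s else 0)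
          + (\<Sum>s<N. if s = r then efin_entry p n (Suc a) c s else 0)
          + (\<Sum>s<N. if s = r then (if r = c then 1 else 0) else 0)"
        unfolding sum.distrib[symmetric] by (intro sum.cong refl) (auto simp: star_entry_def algebra_simps)
      also have "\<dots> = (if r = c then 2 else 0) + (efin_entry p n (Suc a) r c + efin_entry p n (Suc a) c r)"
        using r c a efin_entry_orthogonal[of "Suc a" p r n c] by (simp add: N_def)
      finally show "(\<Sum>s<N. star_entry p n (Suc a) r s * star_entry p n (Suc a) c s) = \<dots>" .
    qed
    also have "\<dots> = (if r = c then 2 * real p else 0) + adj_fin p n $$ (r, c)"
    proof -
      have "(\<Sum>a<p. efin_entry p n (Suc a) r c + efin_entry p n (Suc a) c r) = adj_fin p n $$ (r, c)"
        using r c unfolding N_def by (subst adj_fin_entry) (auto simp: sum.atLeast1_atMost_eq)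
      then show ?thesis by (simp add: sum.distrib[of "\<lambda>a. if r = c then 2 else 0"])
    qed
    finally show "((x * m) \<cdot>\<^sub>m 1\<^sub>m N - B * transpose_mat B) $$ (r, c)
        = ((x * m - 2 * real p) \<cdot>\<^sub>m 1\<^sub>m N - adj_fin p n) $$ (r, c)"
      using r c B carr' by auto
  qed (use B adj_fin_carrier[of p n] in \<open>auto simp: N_def\<close>)
  then show ?thesis
    using det by (simp add: poly_char_poly[OF carr] poly_char_poly[OF adj_fin_carrier] N_def m_def)
qed

section \<open>Multiplicities of the eigenvalues\<close>

text \<open>Two polynomials that agree off a single point are equal, which restores the value
  excluded by the division by \<open>m\<close>.\<close>

lemma char_poly_adj_fin_Suc:
  assumes p: "p \<ge> 1"
  shows "char_poly (adj_fin p (Suc n)) = [:- (2 * (real p - 1)), 1:] ^ ((p - 1) * (p + 1) ^ n)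
      * pcompose (char_poly (adj_fin p n)) [:- 2 * real p, - (2 * (real p - 1)), 1:]" (is "?L = ?R")
proof -
  have eq: "poly (?L - ?R) x = 0" if "x \<noteq> 2 * (real p - 1)" for x
    using poly_char_poly_adj_fin_Suc[OF p that, of n]
    by (simp add: poly_pcompose algebra_simps)
  have "?L - ?R = 0"
  proof (rule ccontr)
    assume "?L - ?R \<noteq> 0"
    then have "finite {x. poly (?L - ?R) x = 0}" by (rule poly_roots_finite)
    then have "finite (- {2 * (real p - 1)})" by (rule finite_subset[rotated]) (use eq in auto)
    then show False by (simp add: infinite_UNIV_char_0)
  qed
  then show ?thesis by simp
qed

text \<open>Depth 0 is the explicit power in the recursion. A deeper point inherits the multiplicity
  of its image one level down: the linear factor at the image, composed with the quadratic, is
  divisible by the linear factor at the point. The depth and the level both drop by one, so the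
  exponent is unchanged.\<close>

lemma linear_power_dvd_char_poly_adj_fin:
  assumes p: "p \<ge> 1" and "y \<in> preim p (real p - 1) k" "k < n"
  shows "[:- (real p - 1 + y), 1:] ^ ((p - 1) * (p + 1) ^ (n - 1 - k)) dvd char_poly (adj_fin p n)"
  using assms(2,3)
proof (induction n arbitrary: y k)
  case (Suc n)
  let ?G = "[:- 2 * real p, - (2 * (real p - 1)), 1:]"
  show ?case
  proof (cases k)
    case 0
    then have "y = real p - 1" using Suc.prems by simp
    then have eq: "real p - 1 + y = 2 * (real p - 1)" by simp
    show ?thesis unfolding char_poly_adj_fin_Suc[OF p] 0 eq by (simp del: power_Suc)
  next
    case (Suc l)
    define u where "u = real p - 1 + qmap p y"
    let ?e = "(p - 1) * (p + 1) ^ (n - 1 - l)"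
    have "[:- u, 1:] ^ ?e dvd char_poly (adj_fin p n)"
      unfolding u_def using Suc.prems Suc by (intro Suc.IH) (auto simp: preim_Suc)
    then obtain h where "char_poly (adj_fin p n) = [:- u, 1:] ^ ?e * h" by blast
    moreover have pow: "pcompose (q ^ e) ?G = (pcompose q ?G) ^ e" for q e
      by (induction e) (simp_all add: pcompose_mult pcompose_1)
    ultimately have "pcompose (char_poly (adj_fin p n)) ?G = (pcompose [:- u, 1:] ?G) ^ ?e * pcompose h ?G"
      by (simp only: pcompose_mult pow)
    moreover have "[:- (real p - 1 + y), 1:] dvd pcompose [:- u, 1:] ?G"
      unfolding poly_eq_0_iff_dvd[symmetric] u_def
      by (simp add: poly_pcompose qmap_def power2_eq_square algebra_simps)
    ultimately have "[:- (real p - 1 + y), 1:] ^ ?e dvd pcompose (char_poly (adj_fin p n)) ?G"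
      by (simp add: dvd_mult2 dvd_power_same)
    then show ?thesis unfolding char_poly_adj_fin_Suc[OF p] using Suc by (simp add: dvd_mult)
  qed
qed simp

lemma order_char_poly_adj_fin:
  assumes "p \<ge> 1" "y \<in> preim p (real p - 1) k" "k < n"
  shows "order (real p - 1 + y) (char_poly (adj_fin p n)) \<ge> (p - 1) * (p + 1) ^ (n - 1 - k)"
proof -
  have "char_poly (adj_fin p n) \<noteq> 0"
    using degree_monic_char_poly[OF adj_fin_carrier[of p n]] by auto
  then show ?thesis
    using linear_power_dvd_char_poly_adj_fin[OF assms] by (simp only: order_divides) simp
qed

section \<open>The spectral measure\<close>

definition level :: "nat \<Rightarrow> nat \<Rightarrow> real set" where
  "level p k = (\<lambda>y. real p - 1 + y) ` preim p (real p - 1) k"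

lemma finite_card_level:
  assumes "p \<ge> 2"
  shows "finite (level p k)" "card (level p k) = 2 ^ k"
  using finite_card_preim[OF assms abs_center_le[OF assms], of k]
  by (auto simp: level_def card_image inj_on_def)

lemma level_disjoint: "p \<ge> 2 \<Longrightarrow> x \<in> level p k \<Longrightarrow> x \<in> level p l \<Longrightarrow> k = l"
  using preim_center_disjoint by (fastforce simp: level_def)

text \<open>Each point of level \<open>k\<close> is weighted with its limiting mass; the sum stops
  below \<open>n\<close> because these are the levels whose multiplicities are controlled in the
  graph on words of length \<open>n\<close>.\<close>

definition level_mass :: "nat \<Rightarrow> nat \<Rightarrow> real set \<Rightarrow> real" where
  "level_mass p n B = (\<Sum>k<n. (real p - 1) / (real p + 1) ^ Suc k * real (card (level p k \<inter> B)))"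

text \<open>Level \<open>k\<close> has \<open>2 ^ k\<close> points, so its total weight is the
  telescoping difference of consecutive powers of \<open>2 / (p + 1)\<close>.\<close>

lemma level_mass_Compl:
  assumes p: "p \<ge> 2"
  shows "level_mass p n B + level_mass p n (- B) = 1 - (2 / (real p + 1)) ^ n"
proof -
  have split: "real (card (level p k \<inter> B)) + real (card (level p k \<inter> - B)) = 2 ^ k" for k
  proof -
    have "card (level p k \<inter> B) + card (level p k \<inter> - B) = card (level p k)"
      using finite_card_level(1)[OF p] by (subst card_Un_disjoint[symmetric]) (auto intro: arg_cong[where f = card])
    then show ?thesis using finite_card_level(2)[OF p, of k]
      by (metis of_nat_add of_nat_numeral of_nat_power)
  qed
  have "level_mass p n B + level_mass p n (- B)
      = (\<Sum>k<n. (real p - 1) / (real p + 1) ^ Suc k * 2 ^ k)"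
    unfolding level_mass_def sum.distrib[symmetric] distrib_left[symmetric] split ..
  also have "\<dots> = 1 - (2 / (real p + 1)) ^ n"
  proof (induction n)
    case (Suc n)
    have "(real p - 1) / (real p + 1) ^ Suc n * 2 ^ n
        = (2 / (real p + 1)) ^ n - (2 / (real p + 1)) ^ Suc n"
      by (simp add: power_divide divide_simps) (simp add: algebra_simps)
    then show ?case using Suc by simp
  qed simp
  finally show ?thesis .
qed

lemma level_mass_le_sum:
  assumes p: "p \<ge> 2" and fin: "finite S" and sub: "(\<Union>k<n. level p k \<inter> B) \<subseteq> S"
    and c: "\<And>x. x \<in> S \<Longrightarrow> c x \<ge> 0"
    and w: "\<And>k x. k < n \<Longrightarrow> x \<in> level p k \<Longrightarrow> c x \<ge> (real p - 1) / (real p + 1) ^ Suc k"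
  shows "level_mass p n B \<le> sum c S"
proof -
  have "level_mass p n B = (\<Sum>k<n. \<Sum>x\<in>level p k \<inter> B. (real p - 1) / (real p + 1) ^ Suc k)"
    by (simp add: level_mass_def mult.commute)
  also have "\<dots> \<le> (\<Sum>k<n. \<Sum>x\<in>level p k \<inter> B. c x)"
    using w by (intro sum_mono) auto
  also have "\<dots> = sum c (\<Union>k<n. level p k \<inter> B)"
    using finite_card_level(1)[OF p] level_disjoint[OF p]
    by (intro sum.UNION_disjoint[symmetric]) auto
  also have "\<dots> \<le> sum c S" using fin sub c by (intro sum_mono2) auto
  finally show ?thesis .
qed

text \<open>The point masses on the first \<open>n\<close> levels already exhaust all but \<open>(2 / (p + 1)) ^ n\<close> of
  the total mass, so two measures that dominate them on a set and on its complement nearly agree.\<close>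

lemma level_mass_squeeze:
  assumes p: "p \<ge> 2"
    and a: "level_mass p n B \<le> a" "level_mass p n (- B) \<le> 1 - a"
    and b: "level_mass p n B \<le> b" "level_mass p n (- B) \<le> 1 - b"
  shows "\<bar>a - b\<bar> \<le> (2 / (real p + 1)) ^ n"
  using level_mass_Compl[OF p, of n B] a b by (simp add: abs_le_iff)

section \<open>Eigenvalue counting measures\<close>

text \<open>\<open>measure_of\<close> keeps the given set function only if it is a measure;
  identifying it with the image of a point measure settles this.\<close>

lemma measure_of_finite_sum:
  fixes c :: "real \<Rightarrow> real"
  assumes S: "finite S" and c: "\<And>x. x \<in> S \<Longrightarrow> c x \<ge> 0" and B: "B \<in> sets borel"
  shows "measure (measure_of UNIV (sets borel) (\<lambda>B. ennreal (\<Sum>x\<in>S \<inter> B. c x))) B = (\<Sum>x\<in>S \<inter> B. c x)"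
proof -
  let ?M = "distr (point_measure S (\<lambda>x. ennreal (c x))) borel (\<lambda>x. x)"
  have em: "emeasure ?M B = ennreal (\<Sum>x\<in>S \<inter> B. c x)" if "B \<in> sets borel" for B
  proof -
    have "emeasure ?M B = emeasure (point_measure S (\<lambda>x. ennreal (c x))) (S \<inter> B)"
      using that by (subst emeasure_distr) (auto simp: space_point_measure Int_commute)
    also have "\<dots> = (\<Sum>x\<in>S \<inter> B. ennreal (c x))"
      using S by (intro emeasure_point_measure_finite) auto
    also have "\<dots> = ennreal (\<Sum>x\<in>S \<inter> B. c x)" using c by (intro sum_ennreal) auto
    finally show ?thesis .
  qed
  have "measure_of UNIV (sets borel) (\<lambda>B. ennreal (\<Sum>x\<in>S \<inter> B. c x))
      = measure_of UNIV (sets borel) (emeasure ?M)"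
  proof (rule measure_of_eq)
    fix A :: "real set" assume "A \<in> sigma_sets UNIV (sets borel)"
    then have "A \<in> sets borel" using sets.sigma_sets_eq[of "borel :: real measure"] by simp
    then show "ennreal (\<Sum>x\<in>S \<inter> A. c x) = emeasure ?M A" by (rule em[symmetric])
  qed simp
  also have "\<dots> = ?M" using measure_of_of_measure[of ?M] by simp
  finally have eq: "measure_of UNIV (sets borel) (\<lambda>B. ennreal (\<Sum>x\<in>S \<inter> B. c x)) = ?M" .
  have "(\<Sum>x\<in>S \<inter> B. c x) \<ge> 0" using c by (intro sum_nonneg) auto
  then show ?thesis unfolding eq measure_def em[OF B] by (rule enn2real_ennreal)
qed

lemma measure_kns_approx:
  assumes "B \<in> sets borel"
  shows "measure (kns_approx p n) B = (\<Sum>x\<in>{x. poly (char_poly (adj_fin p n)) x = 0} \<inter> B.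
      real (order x (char_poly (adj_fin p n))) / real (p + 1) ^ n)"
proof -
  have "char_poly (adj_fin p n) \<noteq> 0"
    using degree_monic_char_poly[OF adj_fin_carrier[of p n]] by auto
  then show ?thesis
    unfolding kns_approx_def using assms by (intro measure_of_finite_sum) (auto intro: poly_roots_finite)
qed

text \<open>The bound on the complement is an upper bound on \<open>B\<close> in disguise: the
  multiplicities add up to at most the degree, so the total mass is at most 1.\<close>

lemma kns_approx_bounds:
  assumes p: "p \<ge> 2" and B: "B \<in> sets borel"
  shows "level_mass p n B \<le> measure (kns_approx p n) B"
    "level_mass p n (- B) \<le> 1 - measure (kns_approx p n) B"
proof -
  let ?P = "char_poly (adj_fin p n)"
  let ?Z = "{x. poly ?P x = 0}"
  let ?c = "\<lambda>x. real (order x ?P) / real (p + 1) ^ n"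
  have P: "?P \<noteq> 0" "degree ?P = (p + 1) ^ n"
    using degree_monic_char_poly[OF adj_fin_carrier[of p n]] by auto
  have fin: "finite ?Z" using P by (simp add: poly_roots_finite)
  have ord: "order x ?P \<ge> (p - 1) * (p + 1) ^ (n - 1 - k)" if "k < n" "x \<in> level p k" for k x
    using that p order_char_poly_adj_fin[of p _ k n] by (auto simp: level_def)
  have w: "?c x \<ge> (real p - 1) / (real p + 1) ^ Suc k" if k: "k < n" and x: "x \<in> level p k" for k x
  proof -
    have "(real p - 1) / (real p + 1) ^ Suc k = (real p - 1) * (real p + 1) ^ (n - 1 - k) / (real p + 1) ^ n"
    proof -
      have "n = (n - 1 - k) + Suc k" using k by simp
      then have "(real p + 1) ^ n = (real p + 1) ^ (n - 1 - k) * (real p + 1) ^ Suc k"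
        by (metis power_add)
      then show ?thesis by simp
    qed
    also have "(real p - 1) * (real p + 1) ^ (n - 1 - k) = real ((p - 1) * (p + 1) ^ (n - 1 - k))"
      using p by (simp add: of_nat_diff add.commute)
    also have "\<dots> / (real p + 1) ^ n \<le> ?c x"
      using ord[OF k x] by (simp add: divide_right_mono add.commute del: of_nat_mult)
    finally show ?thesis .
  qed
  have root: "x \<in> ?Z" if "k < n" "x \<in> level p k" for k x
  proof -
    have "(p - 1) * (p + 1) ^ (n - 1 - k) > 0" using p by simp
    then have "order x ?P \<noteq> 0" using ord[OF that] by linarith
    then show ?thesis using order_root[of ?P x] by simp
  qed
  have mass: "level_mass p n A \<le> sum ?c (?Z \<inter> A)" for A
    using root w fin by (intro level_mass_le_sum[OF p]) auto
  show "level_mass p n B \<le> measure (kns_approx p n) B"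
    unfolding measure_kns_approx[OF B] by (rule mass)
  have "sum ?c (?Z \<inter> B) + sum ?c (?Z \<inter> - B) = sum ?c ?Z"
    using sum.Int_Diff[OF fin, of ?c B] by (simp only: Diff_eq)
  also have "\<dots> = real (\<Sum>x\<in>?Z. order x ?P) / real (p + 1) ^ n"
    by (simp add: sum_divide_distrib)
  also have "\<dots> \<le> real ((p + 1) ^ n) / real (p + 1) ^ n"
    using sum_order_le_degree[OF P(1)] unfolding P(2) by (intro divide_right_mono) (simp_all only: of_nat_le_iff, simp)
  also have "\<dots> = 1" by simp
  finally show "level_mass p n (- B) \<le> 1 - measure (kns_approx p n) B"
    unfolding measure_kns_approx[OF B] using mass[of "- B"] by linarith
qed

section \<open>The limit measure\<close>

text \<open>The total weight of level \<open>k\<close> is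
  \<open>(2 / (p + 1)) ^ k * (p - 1) / (p + 1)\<close>, a geometric law for the level, and within a
  level all points weigh the same.\<close>

definition kns_pmf :: "nat \<Rightarrow> real pmf" where
  "kns_pmf p = bind_pmf (geometric_pmf ((real p - 1) / (real p + 1))) (\<lambda>k. pmf_of_set (level p k))"

lemma level_nonempty: "p \<ge> 2 \<Longrightarrow> level p k \<noteq> {}"
  using finite_card_level[of p k] by (metis card.empty power_eq_0_iff zero_neq_numeral)

lemma pmf_kns_pmf:
  assumes p: "p \<ge> 2" and x: "x \<in> level p n"
  shows "pmf (kns_pmf p) x = (real p - 1) / (real p + 1) ^ Suc n"
proof -
  let ?q = "(real p - 1) / (real p + 1)"
  have q: "0 < ?q" "?q \<le> 1" using p by auto
  have "pmf (kns_pmf p) x = (\<integral>k. pmf (pmf_of_set (level p k)) x \<partial>measure_pmf (geometric_pmf ?q))"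
    by (simp add: kns_pmf_def pmf_bind)
  also have "\<dots> = (\<integral>k. indicator {n} k * (1 / 2 ^ n) \<partial>measure_pmf (geometric_pmf ?q))"
  proof (intro Bochner_Integration.integral_cong refl)
    fix k
    have "pmf (pmf_of_set (level p k)) x = indicator (level p k) x / 2 ^ k"
      by (simp add: pmf_of_set[OF level_nonempty[OF p] finite_card_level(1)[OF p]] finite_card_level(2)[OF p])
    moreover have "indicator (level p k) x / 2 ^ k = indicator {n} k * (1 / 2 ^ n :: real)"
    proof (cases "k = n")
      case False
      then have "x \<notin> level p k" using level_disjoint[OF p x] by blast
      then show ?thesis using False by simp
    qed (use x in simp)
    ultimately show "pmf (pmf_of_set (level p k)) x = indicator {n} k * (1 / 2 ^ n)" by (rule trans)
  qed
  also have "\<dots> = pmf (geometric_pmf ?q) n / 2 ^ n"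
    by (simp add: measure_pmf_single)
  also have "\<dots> = (1 - ?q) ^ n * ?q / 2 ^ n" using q by simp
  also have "1 - ?q = 2 / (real p + 1)" by (simp add: field_simps)
  also have "(2 / (real p + 1)) ^ n * ?q / 2 ^ n = (real p - 1) / (real p + 1) ^ Suc n"
    by (simp add: power_divide)
  finally show ?thesis .
qed

lemma set_kns_pmf:
  assumes p: "p \<ge> 2"
  shows "set_pmf (kns_pmf p) = (\<lambda>y. real p - 1 + y) ` preims p"
proof -
  have "set_pmf (kns_pmf p) = (\<Union>k. level p k)"
    using p finite_card_level(1)[OF p] level_nonempty[OF p]
    by (simp add: kns_pmf_def set_pmf_geometric)
  then show ?thesis by (auto simp: level_def preims_def)
qed

lemma level_mass_le_kns_pmf:
  assumes p: "p \<ge> 2"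
  shows "level_mass p n B \<le> measure (measure_pmf (kns_pmf p)) B"
proof -
  let ?S = "\<Union>k<n. level p k \<inter> B"
  have fin: "finite ?S" using finite_card_level(1)[OF p] by auto
  have "level_mass p n B \<le> sum (pmf (kns_pmf p)) ?S"
    using fin pmf_kns_pmf[OF p] by (intro level_mass_le_sum[OF p]) auto
  also have "\<dots> = measure (measure_pmf (kns_pmf p)) ?S"
    using fin by (simp add: measure_measure_pmf_finite)
  also have "\<dots> \<le> measure (measure_pmf (kns_pmf p)) B"
    by (intro measure_pmf.finite_measure_mono) auto
  finally show ?thesis .
qed

definition kns_measure :: "nat \<Rightarrow> real measure" where
  "kns_measure p = distr (measure_pmf (kns_pmf p)) borel (\<lambda>x. x)"

lemma real_distribution_kns_measure: "real_distribution (kns_measure p)"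
  unfolding kns_measure_def by (rule prob_space.real_distribution_distr[OF prob_space_measure_pmf]) simp

lemma measure_kns_measure:
  "B \<in> sets borel \<Longrightarrow> measure (kns_measure p) B = measure (measure_pmf (kns_pmf p)) B"
  unfolding kns_measure_def by (subst measure_distr) auto

text \<open>The squeeze applied to half-lines: the distribution functions converge at every point,
  atoms included, at a geometric rate.\<close>

lemma weak_conv_kns_measure:
  assumes p: "p \<ge> 2"
  shows "weak_conv_m (kns_approx p) (kns_measure p)"
proof -
  have "(\<lambda>n. cdf (kns_approx p n) x) \<longlonglongrightarrow> cdf (kns_measure p) x" for x
  proof (rule LIM_zero_cancel, rule Lim_null_comparison)
    have B: "{..x} \<in> sets borel" by simp
    have "\<bar>cdf (kns_approx p n) x - cdf (kns_measure p) x\<bar> \<le> (2 / (real p + 1)) ^ n" for n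
      unfolding cdf_def measure_kns_measure[OF B]
    proof (rule level_mass_squeeze[OF p kns_approx_bounds[OF p B] level_mass_le_kns_pmf[OF p]])
      show "level_mass p n (- {..x}) \<le> 1 - measure (measure_pmf (kns_pmf p)) {..x}"
        using level_mass_le_kns_pmf[OF p, of n "- {..x}"] measure_pmf.prob_compl[of "{..x}" "kns_pmf p"]
        by (simp add: Compl_eq_Diff_UNIV)
    qed
    then show "\<forall>\<^sub>F n in sequentially. norm (cdf (kns_approx p n) x - cdf (kns_measure p) x)
        \<le> (2 / (real p + 1)) ^ n"
      by simp
    show "(\<lambda>n. (2 / (real p + 1)) ^ n) \<longlonglongrightarrow> 0"
      using p by (intro LIMSEQ_power_zero) auto
  qed
  then show ?thesis by (simp add: weak_conv_m_def weak_conv_def)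
qed

section \<open>Uniqueness of the weak limit\<close>

text \<open>The two distribution functions agree off the countable set of atoms. By right continuity
  a difference at \<open>x\<close> would persist on an interval to its right, which is
  uncountable.\<close>

lemma weak_conv_m_unique:
  assumes M: "real_distribution M" and N: "real_distribution N"
    and convM: "weak_conv_m F M" and convN: "weak_conv_m F N"
  shows "M = N"
proof (rule cdf_unique[OF M N], rule ext)
  interpret M: real_distribution M by fact
  interpret N: real_distribution N by fact
  fix x
  let ?h = "\<lambda>y. cdf M y - cdf N y"
  let ?D = "{y. measure M {y} > 0} \<union> {y. measure N {y} > 0}"
  have zero: "?h y = 0" if "y \<notin> ?D" for y
  proof -
    have "isCont (cdf M) y" "isCont (cdf N) y"
      using that by (auto simp: M.isCont_cdf N.isCont_cdf not_less measure_le_0_iff)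
    then have "(\<lambda>n. cdf (F n) y) \<longlonglongrightarrow> cdf M y" "(\<lambda>n. cdf (F n) y) \<longlonglongrightarrow> cdf N y"
      using convM convN by (auto simp: weak_conv_m_def weak_conv_def)
    then show ?thesis using LIMSEQ_unique by fastforce
  qed
  show "cdf M x = cdf N x"
  proof (rule ccontr)
    assume "cdf M x \<noteq> cdf N x"
    then have ne: "?h x \<noteq> 0" by simp
    have "(?h \<longlongrightarrow> ?h x) (at_right x)"
      using M.cdf_is_right_cont[of x] N.cdf_is_right_cont[of x]
      by (intro tendsto_diff) (auto simp: continuous_within)
    from tendsto_imp_eventually_ne[OF this ne]
    have "eventually (\<lambda>y. ?h y \<noteq> 0) (at_right x)" .
    then obtain b where b: "b > x" "\<And>y. x < y \<Longrightarrow> y < b \<Longrightarrow> ?h y \<noteq> 0"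
      unfolding eventually_at_right_field by blast
    then have "{x<..<b} \<subseteq> ?D" using zero by fastforce
    moreover have "countable ?D" using M.countable_atoms N.countable_atoms by auto
    ultimately have "countable {x<..<b}" using countable_subset by blast
    then show False using uncountable_open_interval b(1) by blast
  qed
qed

section \<open>Translation to the spectral coordinate and conclusion\<close>

lemma islimpt_translation_iff:
  fixes a :: real
  shows "a + x islimpt (\<lambda>y. a + y) ` S \<longleftrightarrow> x islimpt S"
proof -
  have "b + x islimpt (\<lambda>y. b + y) ` S" if "x islimpt S" for b x :: real and S
    using that by (intro islimpt_isCont_image) (auto intro!: continuous_intros simp: eventually_at_topological)
  from this[of x S a] this[of "a + x" "(\<lambda>y. a + y) ` S" "- a"] show ?thesis
    by (auto simp: image_image)
qed

lemma is_cantor_set_julia: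
  assumes p: "p \<ge> 2"
  shows "is_cantor_set ((\<lambda>y. real p - 1 + y) ` julia p)"
  unfolding is_cantor_set_def
proof (intro conjI ballI)
  have "qmap p (real p + 1) = real p + 1"
    by (simp add: qmap_def power2_eq_square algebra_simps)
  then show "(\<lambda>y. real p - 1 + y) ` julia p \<noteq> {}"
    using preim_fixed_subset_julia[of p "real p + 1" 0] by auto
  show "compact ((\<lambda>y. real p - 1 + y) ` julia p)"
    by (rule compact_translation[OF compact_julia])
  fix x assume "x \<in> (\<lambda>y. real p - 1 + y) ` julia p"
  then obtain y where y: "y \<in> julia p" and x: "x = real p - 1 + y" by blast
  show "x islimpt (\<lambda>y. real p - 1 + y) ` julia p"
    unfolding x islimpt_translation_iff by (rule islimpt_julia[OF p y])
  have "z = x" if K: "connected K" "K \<subseteq> (\<lambda>y. real p - 1 + y) ` julia p" "x \<in> K" "z \<in> K" for K z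
  proof -
    let ?K = "(\<lambda>u. u - (real p - 1)) ` K"
    have "connected ?K" by (intro connected_continuous_image continuous_intros K)
    moreover have "?K \<subseteq> julia p" using K by force
    moreover have "y \<in> ?K" "z - (real p - 1) \<in> ?K" using K(3,4) by (force simp: x)+
    ultimately have "z - (real p - 1) \<in> connected_component_set (julia p) y"
      unfolding connected_component_def by blast
    then show ?thesis unfolding connected_component_julia[OF p y] by (simp add: x)
  qed
  moreover have "x \<in> (\<lambda>y. real p - 1 + y) ` julia p" using y x by blast
  ultimately show "connected_component_set ((\<lambda>y. real p - 1 + y) ` julia p) x = {x}"
    by (auto simp: connected_component_def)
qed

lemma julia_translate_null:
  assumes "p \<ge> 2"
  shows "(\<lambda>y. a + y) ` julia p \<in> null_sets lborel"
proof -
  have "(\<lambda>y. a + y) ` julia p = {x. x - a \<in> julia p}" by force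
  then show ?thesis using null_sets_translation[OF julia_null[OF assms]] by simp
qed

text \<open>The map is even, so the orbits of \<open>y\<close> and \<open>- y\<close> coincide after
  one step; this is the symmetry about \<open>p - 1\<close>.\<close>

lemma uminus_julia:
  assumes "y \<in> julia p" shows "- y \<in> julia p"
proof -
  have "qmap p (- y) = qmap p y" by (simp add: qmap_def)
  then have "(qmap p ^^ Suc n) (- y) = (qmap p ^^ Suc n) y" for n
    by (simp only: funpow_Suc_right o_apply)
  then have "\<bar>(qmap p ^^ n) (- y)\<bar> = \<bar>(qmap p ^^ n) y\<bar>" for n
    by (cases n) (simp, metis)
  then show ?thesis using assms by (simp add: julia_def)
qed

lemma countable_preims: "p \<ge> 2 \<Longrightarrow> countable (preims p)"
  unfolding preims_def using finite_card_preim[OF _ abs_center_le]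
  by (intro countable_UN countableI_type) (auto intro: countable_finite)

theorem theorem3p10:
  fixes p :: nat
  assumes "p \<ge> 2"
  shows "(\<forall>w. (\<forall>n. w n \<le> p) \<and> infinite (orbit p w) \<longrightarrow>
            spec p (orbit p w) = complex_of_real ` spec_set p)
    \<and> (\<exists>C I. spec_set p = C \<union> I \<and> is_cantor_set C \<and> C \<in> null_sets lborel
          \<and> (\<forall>x\<in>C. 2 * (real p - 1) - x \<in> C)
          \<and> countable I \<and> (\<forall>x\<in>I. \<not> x islimpt spec_set p)
          \<and> (\<forall>\<mu>. real_distribution \<mu> \<and> weak_conv_m (kns_approx p) \<mu> \<longrightarrow> measure \<mu> I = 1))
    \<and> (\<exists>\<mu>. real_distribution \<mu> \<and> weak_conv_m (kns_approx p) \<mu>)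
    \<and> (\<forall>\<mu>. real_distribution \<mu> \<and> weak_conv_m (kns_approx p) \<mu> \<longrightarrow>
          measure \<mu> ({2 * (real p - 1)} \<union> (\<Union>n\<in>{1..}. Rset p n)) = 1
          \<and> (\<forall>n\<ge>1. \<forall>x\<in>Rset p n. measure \<mu> {x} = (real p - 1) / (real p + 1) ^ (n + 1))
          \<and> measure \<mu> {2 * (real p - 1)} = (real p - 1) / (real p + 1))"
proof -
  note p = assms
  let ?C = "(\<lambda>y. real p - 1 + y) ` julia p" and ?I = "(\<lambda>y. real p - 1 + y) ` preims p"
  \<comment> \<open>Every statement about an arbitrary weak limit is thereby reduced to one explicit
    measure.\<close>
  have uniq: "\<mu> = kns_measure p" if "real_distribution \<mu> \<and> weak_conv_m (kns_approx p) \<mu>" for \<mu>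
    using that weak_conv_m_unique real_distribution_kns_measure weak_conv_kns_measure[OF p] by blast
  have cI: "countable ?I" using countable_preims[OF p] by simp
  have "?I \<in> sets borel" by (rule sets.countable[OF _ cI]) simp
  then have mI: "measure (kns_measure p) ?I = 1"
    by (simp add: measure_kns_measure set_kns_pmf[OF p, symmetric] measure_pmf.prob_eq_1 AE_measure_pmf)
  have atom: "measure (kns_measure p) {x} = (real p - 1) / (real p + 1) ^ Suc n" if "x \<in> level p n" for x n
    using pmf_kns_pmf[OF p that] by (simp add: measure_kns_measure measure_pmf_single)
  have "spec p (orbit p w) = complex_of_real ` spec_set p" if "\<forall>n. w n \<le> p" for w
  proof (rule spec_invariant[OF p invariant_orbit[OF that]])
    show "orbit p w \<noteq> {}" by (auto simp: orbit_def)
  qed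
  moreover have "\<exists>C I. spec_set p = C \<union> I \<and> is_cantor_set C \<and> C \<in> null_sets lborel
          \<and> (\<forall>x\<in>C. 2 * (real p - 1) - x \<in> C)
          \<and> countable I \<and> (\<forall>x\<in>I. \<not> x islimpt spec_set p)
          \<and> (\<forall>\<mu>. real_distribution \<mu> \<and> weak_conv_m (kns_approx p) \<mu> \<longrightarrow> measure \<mu> I = 1)"
  proof (rule exI[of _ ?C], rule exI[of _ ?I], intro conjI ballI allI impI)
    show "spec_set p = ?C \<union> ?I" by (simp add: spec_set_eq[OF p] image_Un)
    show "is_cantor_set ?C" by (rule is_cantor_set_julia[OF p])
    show "?C \<in> null_sets lborel" by (rule julia_translate_null[OF p])
    show "countable ?I" by (rule cI)
  next
    fix x assume "x \<in> ?C"
    then obtain y where "y \<in> julia p" "x = real p - 1 + y" by blast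
    then show "2 * (real p - 1) - x \<in> ?C"
      using uminus_julia by (intro image_eqI[of _ _ "- y"]) auto
  next
    fix x assume "x \<in> ?I"
    then obtain y where "y \<in> preims p" "x = real p - 1 + y" by blast
    then show "\<not> x islimpt spec_set p"
      unfolding spec_set_eq[OF p] by (simp only: islimpt_translation_iff preims_isolated[OF p] simp_thms)
  next
    fix \<mu> assume "real_distribution \<mu> \<and> weak_conv_m (kns_approx p) \<mu>"
    then show "measure \<mu> ?I = 1" using uniq mI by blast
  qed
  moreover have "\<exists>\<mu>. real_distribution \<mu> \<and> weak_conv_m (kns_approx p) \<mu>"
    using real_distribution_kns_measure weak_conv_kns_measure[OF p] by blast
  moreover have "measure \<mu> ({2 * (real p - 1)} \<union> (\<Union>n\<in>{1..}. Rset p n)) = 1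
          \<and> (\<forall>n\<ge>1. \<forall>x\<in>Rset p n. measure \<mu> {x} = (real p - 1) / (real p + 1) ^ (n + 1))
          \<and> measure \<mu> {2 * (real p - 1)} = (real p - 1) / (real p + 1)"
    if "real_distribution \<mu> \<and> weak_conv_m (kns_approx p) \<mu>" for \<mu>
  proof (intro conjI allI ballI impI)
    show "measure \<mu> ({2 * (real p - 1)} \<union> (\<Union>n\<in>{1..}. Rset p n)) = 1"
      unfolding points_eq_preims[OF p] uniq[OF that] by (rule mI)
    fix n x assume n: "n \<ge> 1" and x: "x \<in> Rset p n"
    obtain m where m: "n = Suc m" using n by (cases n) auto
    have "x \<in> level p n" using x unfolding m level_def Rset_eq_preim[OF p] .
    then show "measure \<mu> {x} = (real p - 1) / (real p + 1) ^ (n + 1)"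
      unfolding uniq[OF that] by (simp add: atom)
  next
    have "2 * (real p - 1) \<in> level p 0" by (simp add: level_def)
    from atom[OF this] show "measure \<mu> {2 * (real p - 1)} = (real p - 1) / (real p + 1)"
      unfolding uniq[OF that] by simp
  qed
  ultimately show ?thesis by blast
qed

end
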